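(* Let $A$ be a left-symmetric conformal algebra and $M$ an $A$-module. For $n\ge1$ let $C^n(A,M)=\mathrm{CHom}(A^{\otimes(n-1)}\otimes A,M)$ be the space of $n$-cochains, and let $\delta:C^n(A,M)\to C^{n+1}(A,M)$ be given, for $\gamma\in C^n(A,M)$ and $a_1,\dots,a_{n+1}\in A$, by $$(\delta\gamma)_{\lambda_1,\dots,\lambda_n}(a_1,\dots,a_{n+1})=\sum_{i=1}^n(-1)^{i+1}{a_i}_{\lambda_i}\gamma_{\lambda_1,\dots,\hat\lambda_i,\dots,\lambda_n}(a_1,\dots,\hat a_i,\dots,a_{n+1})$$ $$+\sum_{i=1}^n(-1)^{i+1}\gamma_{\lambda_1,\dots,\hat\lambda_i,\dots,\lambda_n}(a_1,\dots,\hat a_i,\dots,a_n,a_i)_{\lambda_1+\cdots+\lambda_n}a_{n+1}-\sum_{i=1}^n(-1)^{i+1}\gamma_{\lambda_1,\dots,\hat\lambda_i,\dots,\lambda_n}(a_1,\dots,\hat a_i,\dots,a_n,{a_i}_{\lambda_i}a_{n+1})$$ $$+\sum_{1\le i<j\le n}(-1)^{i+j}\gamma_{\lambda_i+\lambda_j,\lambda_1,\dots,\hat\lambda_{i,j},\dots,\lambda_n}([{a_i}_{\lambda_i}a_j],a_1,\dots,\hat a_{i,j},\dots,a_{n+1}),$$ where $[a_\lambda b]=a_\lambda b-b_{-\partial-\lambda}a$. Then $\delta^2=0$.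
   Context: All of $A$, $M$ are finitely generated $\mathbb{C}[\partial]$-modules. Products and actions are extended coefficientwise to polynomials in the variables $\lambda_i$; $b_{-\partial-\lambda}a$ means: write $b_\mu a=\sum_k\mu^k x_k$ and take $\sum_k(-\partial-\lambda)^k x_k$. A hat means omission. A left-symmetric conformal algebra is a $\mathbb{C}[\partial]$-module $A$ with a $\mathbb{C}$-linear map $A\otimes A\to A[\lambda]$, $a\otimes b\mapsto a_\lambda b$, such that $(\partial a)_\lambda b=-\lambda a_\lambda b$, $a_\lambda(\partial b)=(\partial+\lambda)a_\lambda b$ and $(a_\lambda b)_{\lambda+\mu}c-a_\lambda(b_\mu c)=(b_\mu a)_{\lambda+\mu}c-b_\mu(a_\lambda c)$. An $A$-module is a $\mathbb{C}[\partial]$-module $M$ with $\mathbb{C}$-linear maps $a\otimes v\mapsto a_\lambda v\in M[\lambda]$ and $v\otimes a\mapsto v_\lambda a\in M[\lambda]$ ($a\in A,v\in M$) such that $(\partial a)_\lambda v=-\lambda a_\lambda v$, $a_\lambda(\partial v)=(\partial+\lambda)a_\lambda v$, $(\partial v)_\lambda a=-\lambda v_\lambda a$, $v_\lambda(\partial a)=(\partial+\lambda)v_\lambda a$, $(a_\lambda b)_{\lambda+\mu}v-a_\lambda(b_\mu v)=(b_\mu a)_{\lambda+\mu}v-b_\mu(a_\lambda v)$ and $(a_\lambda v)_{\lambda+\mu}b-a_\lambda(v_\mu b)=(v_\mu a)_{\lambda+\mu}b-v_\mu(a_\lambda b)$. $\mathrm{CHom}(A^{\otimes(n-1)}\otimes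 A,M)$ is the set of $\mathbb{C}$-linear maps $\gamma_{\lambda_1,\dots,\lambda_{n-1}}:A^{\otimes n}\to M[\lambda_1,\dots,\lambda_{n-1}]$ such that $\gamma_{\lambda_1,\dots,\lambda_{n-1}}(a_1,\dots,\partial a_i,\dots,a_n)=-\lambda_i\gamma_{\lambda_1,\dots,\lambda_{n-1}}(a_1,\dots,a_n)$ for $1\le i\le n-1$, $\gamma_{\lambda_1,\dots,\lambda_{n-1}}(a_1,\dots,\partial a_n)=(\partial+\lambda_1+\cdots+\lambda_{n-1})\gamma_{\lambda_1,\dots,\lambda_{n-1}}(a_1,\dots,a_n)$, and $\gamma$ changes sign under simultaneous interchange of $a_i,a_j$ and of $\lambda_i,\lambda_j$ for $1\le i<j\le n-1$. For $n=1$ these are the $\mathbb{C}[\partial]$-module homomorphisms $A\to M$. *)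

theory Defs
  imports
    Complex_Main
    "HOL-Computational_Algebra.Polynomial"
    "HOL-Library.Poly_Mapping"
    "HOL-Combinatorics.Transposition"
begin

section \<open>Finitely generated modules over the ring of polynomials in \<open>\<partial>\<close>\<close>

text \<open>
  A \<open>\<complex>[\<partial>]\<close>-module is a module over \<^typ>\<open>complex poly\<close>, the polynomial variable being \<open>\<partial>\<close>.
  The underlying complex vector space has scalar multiplication \<^term>\<open>\<lambda>c. s [:c:]\<close>.
\<close>

locale fg_module = module scale
  for scale :: "complex poly \<Rightarrow> 'a::ab_group_add \<Rightarrow> 'a" +
  assumes finitely_generated: "\<exists>S. finite S \<and> span S = UNIV"

abbreviation dpart :: "(complex poly \<Rightarrow> 'a \<Rightarrow> 'a) \<Rightarrow> 'a \<Rightarrow> 'a" where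
  "dpart s \<equiv> s [:0, 1:]"


section \<open>Polynomials in the variables \<open>\<lambda>\<^sub>0, \<lambda>\<^sub>1, \<dots>\<close> with coefficients in a module\<close>

text \<open>
  A monomial is a finitely supported exponent function. For a \<open>\<complex>[\<partial>]\<close>-module \<open>M\<close>, the elements of
  \<open>M[\<lambda>\<^sub>0, \<lambda>\<^sub>1, \<dots>]\<close> have type \<open>'m lpoly\<close>; they form a module over the ring
  \<open>\<complex>[\<partial>][\<lambda>\<^sub>0, \<lambda>\<^sub>1, \<dots>]\<close>, of type \<open>complex poly lpoly\<close>.
  Variables and list positions are numbered from \<open>0\<close>, so \<open>\<lambda>\<^sub>i\<close> goes with the entry \<open>as ! i\<close>.
\<close>

type_synonym 'a lpoly = "(nat \<Rightarrow>\<^sub>0 nat) \<Rightarrow>\<^sub>0 'a"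

definition lconst :: "'a::zero \<Rightarrow> 'a lpoly" where
  "lconst x = Poly_Mapping.single 0 x"

definition lam :: "nat \<Rightarrow> complex poly lpoly" where
  "lam i = Poly_Mapping.single (Poly_Mapping.single i 1) 1"

definition dsym :: "complex poly lpoly" where
  "dsym = lconst [:0, 1:]"

definition in_vars :: "nat \<Rightarrow> 'a::zero lpoly \<Rightarrow> bool" where
  "in_vars k p \<longleftrightarrow> (\<forall>\<alpha>\<in>Poly_Mapping.keys p. Poly_Mapping.keys \<alpha> \<subseteq> {..<k})"

definition lsmult ::
    "(complex poly \<Rightarrow> 'm \<Rightarrow> 'm) \<Rightarrow> complex poly lpoly \<Rightarrow> 'm::ab_group_add lpoly \<Rightarrow> 'm lpoly" where
  "lsmult s r p = (\<Sum>\<alpha>\<in>Poly_Mapping.keys r. \<Sum>\<beta>\<in>Poly_Mapping.keys p.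
     Poly_Mapping.single (\<alpha> + \<beta>) (s (Poly_Mapping.lookup r \<alpha>) (Poly_Mapping.lookup p \<beta>)))"

text \<open>
  \<open>ev s L x\<close> substitutes \<open>L\<close> for \<open>\<mu>\<close> in \<open>x = \<Sum>k. \<mu>\<^sup>k x\<^sub>k\<close>. As \<open>L\<close> may involve \<open>\<partial>\<close>,
  this covers both \<open>a\<^bsub>\<lambda>+\<mu>\<^esub> b\<close> and \<open>b\<^bsub>-\<partial>-\<lambda>\<^esub> a\<close>.
\<close>
definition ev ::
    "(complex poly \<Rightarrow> 'm \<Rightarrow> 'm) \<Rightarrow> complex poly lpoly \<Rightarrow> 'm::ab_group_add poly \<Rightarrow> 'm lpoly" where
  "ev s L x = (\<Sum>k\<le>degree x. lsmult s (L ^ k) (lconst (coeff x k)))"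

text \<open>\<open>subst s \<sigma> p\<close> substitutes \<open>\<sigma> j\<close> for the variable \<open>\<lambda>\<^sub>j\<close> in \<open>p\<close>.\<close>
definition subst ::
    "(complex poly \<Rightarrow> 'm \<Rightarrow> 'm) \<Rightarrow> (nat \<Rightarrow> complex poly lpoly) \<Rightarrow> 'm::ab_group_add lpoly \<Rightarrow> 'm lpoly" where
  "subst s \<sigma> p = (\<Sum>\<alpha>\<in>Poly_Mapping.keys p.
     lsmult s (\<Prod>j\<in>Poly_Mapping.keys \<alpha>. \<sigma> j ^ Poly_Mapping.lookup \<alpha> j)
       (lconst (Poly_Mapping.lookup p \<alpha>)))"

text \<open>
  Coefficientwise extension of a linear map \<open>f\<close> on \<open>A\<close>, with values in \<open>M[\<lambda>\<^sub>0, \<lambda>\<^sub>1, \<dots>]\<close>, to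
  \<open>A[\<lambda>\<^sub>0, \<lambda>\<^sub>1, \<dots>]\<close>: \<open>\<Sum>\<alpha>. \<lambda>\<^sup>\<alpha> x\<^sub>\<alpha> \<mapsto> \<Sum>\<alpha>. \<lambda>\<^sup>\<alpha> f x\<^sub>\<alpha>\<close>.
\<close>
definition ext ::
    "(complex poly \<Rightarrow> 'm \<Rightarrow> 'm) \<Rightarrow> ('a::zero \<Rightarrow> 'm::ab_group_add lpoly) \<Rightarrow> 'a lpoly \<Rightarrow> 'm lpoly" where
  "ext s f p = (\<Sum>\<alpha>\<in>Poly_Mapping.keys p.
     lsmult s (Poly_Mapping.single \<alpha> 1) (f (Poly_Mapping.lookup p \<alpha>)))"


section \<open>Left-symmetric conformal algebras and their modules\<close>

text \<open>
  A \<open>\<lambda>\<close>-product is a map \<open>A \<otimes> B \<rightarrow> C[\<lambda>]\<close>, given as a \<open>\<complex>\<close>-bilinear map into polynomials in one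
  variable, satisfying the two sesquilinearity conditions; these are identities in \<open>C[\<lambda>\<^sub>0]\<close>.
\<close>
definition lam_product ::
    "(complex poly \<Rightarrow> 'a \<Rightarrow> 'a) \<Rightarrow> (complex poly \<Rightarrow> 'b \<Rightarrow> 'b) \<Rightarrow> (complex poly \<Rightarrow> 'c \<Rightarrow> 'c) \<Rightarrow>
     ('a::ab_group_add \<Rightarrow> 'b::ab_group_add \<Rightarrow> 'c::ab_group_add poly) \<Rightarrow> bool" where
  "lam_product sA sB sC m \<longleftrightarrow>
     (\<forall>b. Vector_Spaces.linear (\<lambda>c. sA [:c:]) (\<lambda>c. map_poly (sC [:c:])) (\<lambda>a. m a b)) \<and>
     (\<forall>a. Vector_Spaces.linear (\<lambda>c. sB [:c:]) (\<lambda>c. map_poly (sC [:c:])) (\<lambda>b. m a b)) \<and>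
     (\<forall>a b. ev sC (lam 0) (m (dpart sA a) b) = lsmult sC (- lam 0) (ev sC (lam 0) (m a b))) \<and>
     (\<forall>a b. ev sC (lam 0) (m a (dpart sB b)) = lsmult sC (dsym + lam 0) (ev sC (lam 0) (m a b)))"

text \<open>In the identities below, \<open>\<lambda> = lam 0\<close> and \<open>\<mu> = lam 1\<close>.\<close>

locale left_symmetric_conformal_algebra = fg_module sA
  for sA :: "complex poly \<Rightarrow> 'a::ab_group_add \<Rightarrow> 'a" +
  fixes mul :: "'a \<Rightarrow> 'a \<Rightarrow> 'a poly"
  assumes mul: "lam_product sA sA sA mul"
    and left_symmetry:
      "ext sA (\<lambda>x. ev sA (lam 0 + lam 1) (mul x c)) (ev sA (lam 0) (mul a b))
         - ext sA (\<lambda>x. ev sA (lam 0) (mul a x)) (ev sA (lam 1) (mul b c))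
       = ext sA (\<lambda>x. ev sA (lam 0 + lam 1) (mul x c)) (ev sA (lam 1) (mul b a))
         - ext sA (\<lambda>x. ev sA (lam 1) (mul b x)) (ev sA (lam 0) (mul a c))"

locale lsca_module =
  left_symmetric_conformal_algebra sA mul + M: fg_module sM
  for sA :: "complex poly \<Rightarrow> 'a::ab_group_add \<Rightarrow> 'a"
    and mul :: "'a \<Rightarrow> 'a \<Rightarrow> 'a poly"
    and sM :: "complex poly \<Rightarrow> 'm::ab_group_add \<Rightarrow> 'm" +
  fixes lact :: "'a \<Rightarrow> 'm \<Rightarrow> 'm poly"
    and ract :: "'m \<Rightarrow> 'a \<Rightarrow> 'm poly"
  assumes lact: "lam_product sA sM sM lact"
    and ract: "lam_product sM sA sM ract"
    and left_module:
      "ext sM (\<lambda>x. ev sM (lam 0 + lam 1) (lact x v)) (ev sA (lam 0) (mul a b))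
         - ext sM (\<lambda>w. ev sM (lam 0) (lact a w)) (ev sM (lam 1) (lact b v))
       = ext sM (\<lambda>x. ev sM (lam 0 + lam 1) (lact x v)) (ev sA (lam 1) (mul b a))
         - ext sM (\<lambda>w. ev sM (lam 1) (lact b w)) (ev sM (lam 0) (lact a v))"
    and right_module:
      "ext sM (\<lambda>w. ev sM (lam 0 + lam 1) (ract w b)) (ev sM (lam 0) (lact a v))
         - ext sM (\<lambda>w. ev sM (lam 0) (lact a w)) (ev sM (lam 1) (ract v b))
       = ext sM (\<lambda>w. ev sM (lam 0 + lam 1) (ract w b)) (ev sM (lam 1) (ract v a))
         - ext sM (\<lambda>x. ev sM (lam 1) (ract v x)) (ev sA (lam 0) (mul a b))"


section \<open>Cochains and the coboundary\<close>

text \<open>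
  \<open>cochains sA sM n\<close> is \<open>C\<^sup>n(A,M)\<close> for \<open>n \<ge> 1\<close>. A linear map on \<open>A\<^sup>\<otimes>\<^sup>n\<close> is represented by a
  multilinear function of lists of length \<open>n\<close>, extended by \<open>0\<close> to lists of other lengths.
\<close>
definition cochains ::
    "(complex poly \<Rightarrow> 'a::ab_group_add \<Rightarrow> 'a) \<Rightarrow> (complex poly \<Rightarrow> 'm::ab_group_add \<Rightarrow> 'm) \<Rightarrow>
     nat \<Rightarrow> ('a list \<Rightarrow> 'm lpoly) set" where
  "cochains sA sM n = {\<gamma>.
     (\<forall>as. length as \<noteq> n \<longrightarrow> \<gamma> as = 0) \<and>
     (\<forall>as. length as = n \<longrightarrow>
        in_vars (n - 1) (\<gamma> as) \<and>
        (\<forall>i<n. Vector_Spaces.linear (\<lambda>c. sA [:c:]) (\<lambda>c. lsmult sM (lconst [:c:]))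
                 (\<lambda>x. \<gamma> (as[i := x]))) \<and>
        (\<forall>i<n - 1. \<gamma> (as[i := dpart sA (as ! i)]) = lsmult sM (- lam i) (\<gamma> as)) \<and>
        \<gamma> (as[n - 1 := dpart sA (as ! (n - 1))])
          = lsmult sM (dsym + (\<Sum>j<n - 1. lam j)) (\<gamma> as) \<and>
        (\<forall>i j. i < j \<and> j < n - 1 \<longrightarrow>
           subst sM (\<lambda>k. lam (transpose i j k)) (\<gamma> (as[i := as ! j, j := as ! i])) = - \<gamma> as))}"

text \<open>\<open>at_params s \<gamma> Ls as\<close> is \<open>\<gamma>\<^bsub>L\<^sub>0,L\<^sub>1,\<dots>\<^esub>(a\<^sub>0, a\<^sub>1, \<dots>)\<close>.\<close>
definition at_params ::
    "(complex poly \<Rightarrow> 'm \<Rightarrow> 'm) \<Rightarrow> ('a list \<Rightarrow> 'm::ab_group_add lpoly) \<Rightarrow>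
     complex poly lpoly list \<Rightarrow> 'a list \<Rightarrow> 'm lpoly" where
  "at_params s \<gamma> Ls as = subst s (\<lambda>j. Ls ! j) (\<gamma> as)"

definition omit :: "nat \<Rightarrow> 'b list \<Rightarrow> 'b list" where
  "omit i xs = take i xs @ drop (Suc i) xs"

definition omit2 :: "nat \<Rightarrow> nat \<Rightarrow> 'b list \<Rightarrow> 'b list" where
  "omit2 i j xs = omit i (omit j xs)" \<comment> \<open>used only for \<open>i < j\<close>\<close>

definition bracket ::
    "(complex poly \<Rightarrow> 'a \<Rightarrow> 'a) \<Rightarrow> ('a \<Rightarrow> 'a \<Rightarrow> 'a::ab_group_add poly) \<Rightarrow>
     complex poly lpoly \<Rightarrow> 'a \<Rightarrow> 'a \<Rightarrow> 'a lpoly" where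
  "bracket sA mul L a b = ev sA L (mul a b) - ev sA (- dsym - L) (mul b a)"

text \<open>
  \<open>coboundary \<dots> n\<close> is \<open>\<delta> : C\<^sup>n(A,M) \<rightarrow> C\<^sup>n\<^sup>+\<^sup>1(A,M)\<close>. With indices starting at \<open>0\<close>, the last argument
  is \<open>as ! n\<close>, the sign \<open>(-1)\<^sup>i\<^sup>+\<^sup>1\<close> becomes \<open>(-1)\<^sup>i\<close>, and \<open>(-1)\<^sup>i\<^sup>+\<^sup>j\<close> is unchanged.
\<close>
definition coboundary ::
    "(complex poly \<Rightarrow> 'a::ab_group_add \<Rightarrow> 'a) \<Rightarrow> ('a \<Rightarrow> 'a \<Rightarrow> 'a poly) \<Rightarrow>
     (complex poly \<Rightarrow> 'm::ab_group_add \<Rightarrow> 'm) \<Rightarrow> ('a \<Rightarrow> 'm \<Rightarrow> 'm poly) \<Rightarrow> ('m \<Rightarrow> 'a \<Rightarrow> 'm poly) \<Rightarrow>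
     nat \<Rightarrow> ('a list \<Rightarrow> 'm lpoly) \<Rightarrow> ('a list \<Rightarrow> 'm lpoly)" where
  "coboundary sA mul sM lact ract n \<gamma> as =
     (if length as \<noteq> n + 1 then 0 else
      let Ls = map lam [0..<n]; bs = butlast as in
        (\<Sum>i<n. lsmult sM ((-1) ^ i)
           (ext sM (\<lambda>v. ev sM (lam i) (lact (as ! i) v))
              (at_params sM \<gamma> (omit i Ls) (omit i as))))
      + (\<Sum>i<n. lsmult sM ((-1) ^ i)
           (ext sM (\<lambda>v. ev sM (\<Sum>j<n. lam j) (ract v (as ! n)))
              (at_params sM \<gamma> (omit i Ls) (omit i bs @ [as ! i]))))
      - (\<Sum>i<n. lsmult sM ((-1) ^ i)
           (ext sM (\<lambda>x. at_params sM \<gamma> (omit i Ls) (omit i bs @ [x]))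
              (ev sA (lam i) (mul (as ! i) (as ! n)))))
      + (\<Sum>j<n. \<Sum>i<j. lsmult sM ((-1) ^ (i + j))
           (ext sM (\<lambda>x. at_params sM \<gamma> ((lam i + lam j) # omit2 i j Ls) (x # omit2 i j as))
              (bracket sA mul (lam i) (as ! i) (as ! j)))))"

end

theory Submission
  imports Defs "HOL-Library.Function_Algebras"
begin

text \<open>
  A polynomial with coefficients in \<open>M\<close> is determined by its values at complex assignments, so every
  identity may be checked after substituting numbers for the \<open>\<lambda>\<^sub>i\<close>. The symbols \<open>(l, a)\<close> with
  \<open>l \<in> \<complex>\<close> and product \<open>(l, a) (m, b) = (l + m, a\<^bsub>l\<^esub> b)\<close> then form a graded left-symmetric algebra,
  whose commutator is a graded Lie bracket. It acts on graded conformal homomorphisms \<open>F : A \<rightarrow> M\<close> by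
  \<open>(a \<cdot> F)(b) = a F(b) + F(a) b - F(a b)\<close>, and \<open>\<delta>\<close> becomes the Lie algebra differential with these
  coefficients, the last argument of a cochain being that of \<open>F\<close>. Defining the differential
  recursively by Cartan's formula \<open>\<iota>\<^sub>x d + d \<iota>\<^sub>x = \<theta>\<^sub>x\<close> gives \<open>d\<^sup>2 = 0\<close> and the skew symmetry of \<open>d \<gamma>\<close> by
  induction on the number of arguments.
\<close>

section \<open>Evaluation of polynomials with module coefficients\<close>

text \<open>The obstacle is \<partial>. Giving numbers to the variables leaves \<partial> acting as
  an operator, and the half of the conformal bracket taken at -\<partial>-l has no numerical
  parameter in \<open>A\<close>. It acquires one only inside a cochain: the first slot carries the
  parameter l + k, which turns \<partial> into -(l + k) and hence -\<partial>-l into k. Therefore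
  \<open>commutator\<close> uses k from the outset. This makes the Jacobi identity exact in
  \<open>A\<close>, whereas sesquilinearity of the bracket is available only under a map that treats
  \<partial> as a number; hence the shape of \<open>br_right\<close>. The last argument has no
  parameter and keeps \<partial>, so it cannot be a slot of this kind and moves into the
  coefficients. Their degree records the sum of all parameters, at which the right action in the
  coboundary is taken. The formula for the coboundary agrees with the recursive differential on
  alternating maps, so the image of a cochain has to be recognised as a cochain before the
  coboundary is applied again.\<close>

definition monom_eval :: "(nat \<Rightarrow> complex) \<Rightarrow> (nat \<Rightarrow>\<^sub>0 nat) \<Rightarrow> complex" where
  "monom_eval \<phi> \<alpha> = (\<Prod>j\<in>Poly_Mapping.keys \<alpha>. \<phi> j ^ Poly_Mapping.lookup \<alpha> j)"

lemma monom_eval_superset: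
  assumes "finite S" "Poly_Mapping.keys \<alpha> \<subseteq> S"
  shows "monom_eval \<phi> \<alpha> = (\<Prod>j\<in>S. \<phi> j ^ Poly_Mapping.lookup \<alpha> j)"
  unfolding monom_eval_def using assms
  by (intro prod.mono_neutral_left) (auto simp: in_keys_iff)

lemma monom_eval_0 [simp]: "monom_eval \<phi> 0 = 1"
  by (simp add: monom_eval_def)

lemma monom_eval_single [simp]: "monom_eval \<phi> (Poly_Mapping.single i k) = \<phi> i ^ k"
  by (simp add: monom_eval_def)

lemma monom_eval_add [simp]: "monom_eval \<phi> (\<alpha> + \<beta>) = monom_eval \<phi> \<alpha> * monom_eval \<phi> \<beta>"
proof -
  let ?S = "Poly_Mapping.keys \<alpha> \<union> Poly_Mapping.keys \<beta>"
  have "monom_eval \<phi> (\<alpha> + \<beta>) = (\<Prod>j\<in>?S. \<phi> j ^ Poly_Mapping.lookup (\<alpha> + \<beta>) j)"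
    by (rule monom_eval_superset) (simp_all add: keys_add)
  also have "\<dots> = (\<Prod>j\<in>?S. \<phi> j ^ Poly_Mapping.lookup \<alpha> j) * (\<Prod>j\<in>?S. \<phi> j ^ Poly_Mapping.lookup \<beta> j)"
    by (simp add: lookup_add power_add prod.distrib)
  also have "\<dots> = monom_eval \<phi> \<alpha> * monom_eval \<phi> \<beta>"
    by (simp add: monom_eval_superset[of ?S])
  finally show ?thesis .
qed

lemma monom_eval_mult [simp]:
  "monom_eval (\<lambda>j. \<phi> j * \<psi> j) \<alpha> = monom_eval \<phi> \<alpha> * monom_eval \<psi> \<alpha>"
  by (simp add: monom_eval_def power_mult_distrib prod.distrib)

text \<open>The exponents differ at some \<open>j\<close>; the value 2 there and 1 elsewhere turns
  each monomial into 2 to that exponent.\<close>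

lemma monom_eval_separates:
  assumes "\<alpha> \<noteq> \<beta>"
  obtains \<psi> where "monom_eval \<psi> \<alpha> \<noteq> monom_eval \<psi> \<beta>"
proof -
  obtain j where j: "Poly_Mapping.lookup \<alpha> j \<noteq> Poly_Mapping.lookup \<beta> j"
    using assms by (auto intro: poly_mapping_eqI)
  let ?\<psi> = "\<lambda>i. if i = j then 2 else 1 :: complex"
  have *: "monom_eval ?\<psi> \<delta> = 2 ^ Poly_Mapping.lookup \<delta> j" for \<delta>
  proof -
    have "monom_eval ?\<psi> \<delta> = (\<Prod>i\<in>insert j (Poly_Mapping.keys \<delta>). ?\<psi> i ^ Poly_Mapping.lookup \<delta> i)"
      by (rule monom_eval_superset) auto
    also have "\<dots> = ?\<psi> j ^ Poly_Mapping.lookup \<delta> j"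
      by (subst prod.insert_remove) (auto intro!: prod.neutral)
    finally show ?thesis by simp
  qed
  have "(2::complex) ^ k = 2 ^ l \<Longrightarrow> k = l" for k l :: nat
  proof -
    assume "(2::complex) ^ k = 2 ^ l"
    then have "(2::real) ^ k = 2 ^ l"
      by (metis norm_numeral norm_power)
    then show "k = l" by simp
  qed
  then have "monom_eval ?\<psi> \<alpha> \<noteq> monom_eval ?\<psi> \<beta>"
    using j * by metis
  then show ?thesis using that by blast
qed

lemma poly_mapping_sum_single:
  assumes "finite S" "Poly_Mapping.keys p \<subseteq> S"
  shows "p = (\<Sum>\<alpha>\<in>S. Poly_Mapping.single \<alpha> (Poly_Mapping.lookup p \<alpha>))"
proof (rule poly_mapping_eqI)
  fix \<alpha>
  show "Poly_Mapping.lookup p \<alpha>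
      = Poly_Mapping.lookup (\<Sum>\<alpha>\<in>S. Poly_Mapping.single \<alpha> (Poly_Mapping.lookup p \<alpha>)) \<alpha>"
    using assms by (auto simp: lookup_sum lookup_single when_def in_keys_iff)
qed

text \<open>Only the variables become numbers; \<partial> still acts on the value.\<close>

definition lpoly_eval :: "(complex poly \<Rightarrow> 'm \<Rightarrow> 'm) \<Rightarrow> (nat \<Rightarrow> complex) \<Rightarrow> 'm::ab_group_add lpoly \<Rightarrow> 'm" where
  "lpoly_eval s \<phi> p = (\<Sum>\<alpha>\<in>Poly_Mapping.keys p. s [:monom_eval \<phi> \<alpha>:] (Poly_Mapping.lookup p \<alpha>))"

text \<open>The substituted \<open>z\<close> is a polynomial in \<partial>, in order to cover
  -\<partial>-\<lambda>.\<close>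

definition cpoly_eval :: "(complex poly \<Rightarrow> 'm \<Rightarrow> 'm) \<Rightarrow> complex poly \<Rightarrow> 'm::ab_group_add poly \<Rightarrow> 'm" where
  "cpoly_eval s z x = (\<Sum>k\<le>degree x. s (z ^ k) (coeff x k))"

locale poly_module = module s for s :: "complex poly \<Rightarrow> 'm::ab_group_add \<Rightarrow> 'm"
begin

abbreviation "eval \<equiv> lpoly_eval s"

lemma eval_superset:
  assumes "finite S" "Poly_Mapping.keys p \<subseteq> S"
  shows "eval \<phi> p = (\<Sum>\<alpha>\<in>S. s [:monom_eval \<phi> \<alpha>:] (Poly_Mapping.lookup p \<alpha>))"
  unfolding lpoly_eval_def using assms
  by (intro sum.mono_neutral_left) (auto simp: in_keys_iff)

lemma eval_0 [simp]: "eval \<phi> 0 = 0"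
  by (simp add: lpoly_eval_def)

lemma eval_single [simp]: "eval \<phi> (Poly_Mapping.single \<alpha> x) = s [:monom_eval \<phi> \<alpha>:] x"
  by (simp add: lpoly_eval_def)

lemma eval_lconst [simp]: "eval \<phi> (lconst x) = x"
  by (simp add: lconst_def flip: one_pCons)

lemma eval_add [simp]: "eval \<phi> (p + q) = eval \<phi> p + eval \<phi> q"
proof -
  let ?S = "Poly_Mapping.keys p \<union> Poly_Mapping.keys q"
  have "eval \<phi> (p + q) = (\<Sum>\<alpha>\<in>?S. s [:monom_eval \<phi> \<alpha>:] (Poly_Mapping.lookup (p + q) \<alpha>))"
    by (rule eval_superset) (simp_all add: keys_add)
  then show ?thesis
    by (simp add: lookup_add scale_right_distrib sum.distrib eval_superset[of ?S])
qed

lemma eval_uminus [simp]: "eval \<phi> (- p) = - eval \<phi> p"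
  by (metis add_eq_0_iff eval_0 eval_add add.right_inverse)

lemma eval_diff [simp]: "eval \<phi> (p - q) = eval \<phi> p - eval \<phi> q"
  using eval_add[of \<phi> p "- q"] by simp

lemma eval_sum [simp]: "eval \<phi> (sum f I) = (\<Sum>i\<in>I. eval \<phi> (f i))"
  by (induction I rule: infinite_finite_induct) auto

lemma eval_lsmult [simp]: "eval \<phi> (lsmult s r p) = s (lpoly_eval (*) \<phi> r) (eval \<phi> p)"
proof -
  have "eval \<phi> (lsmult s r p) = (\<Sum>\<alpha>\<in>Poly_Mapping.keys r. \<Sum>\<beta>\<in>Poly_Mapping.keys p.
      s ([:monom_eval \<phi> \<alpha>:] * Poly_Mapping.lookup r \<alpha>)
        (s [:monom_eval \<phi> \<beta>:] (Poly_Mapping.lookup p \<beta>)))"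
    by (simp add: lsmult_def mult.commute)
  also have "\<dots> = s (lpoly_eval (*) \<phi> r) (eval \<phi> p)"
    unfolding lpoly_eval_def by (subst scale_sum_left) (simp only: scale_sum_right)
  finally show ?thesis .
qed

text \<open>Artin's argument: the monomials are pairwise distinct characters of the multiplicative
  monoid of assignments, hence linearly independent.\<close>
lemma monom_eval_independent:
  assumes "finite S" "\<And>\<phi>. (\<Sum>\<alpha>\<in>S. s [:monom_eval \<phi> \<alpha>:] (x \<alpha>)) = 0" "\<alpha> \<in> S"
  shows "x \<alpha> = 0"
  using assms
proof (induction S arbitrary: x \<alpha> rule: finite_induct)
  case (insert \<beta> S)
  have S: "x \<alpha> = 0" if \<alpha>: "\<alpha> \<in> S" for \<alpha>
  proof -
    obtain \<psi> where \<psi>: "monom_eval \<psi> \<alpha> \<noteq> monom_eval \<psi> \<beta>"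
      using \<alpha> insert.hyps by (metis monom_eval_separates)
    \<comment> \<open>Evaluating at the pointwise product with \<open>\<psi>\<close> and subtracting
      \<open>monom_eval \<psi> \<beta>\<close> times the original relation cancels the
      \<open>\<beta>\<close> term.\<close>
    have "(\<Sum>\<alpha>\<in>S. s [:monom_eval \<phi> \<alpha>:] (s [:monom_eval \<psi> \<alpha> - monom_eval \<psi> \<beta>:] (x \<alpha>))) = 0" for \<phi>
    proof -
      have "(\<Sum>\<alpha>\<in>insert \<beta> S. s [:monom_eval \<phi> \<alpha>:] (s [:monom_eval \<psi> \<alpha> - monom_eval \<psi> \<beta>:] (x \<alpha>)))
          = (\<Sum>\<alpha>\<in>insert \<beta> S. s [:monom_eval (\<lambda>j. \<phi> j * \<psi> j) \<alpha>:] (x \<alpha>))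
          - s [:monom_eval \<psi> \<beta>:] (\<Sum>\<alpha>\<in>insert \<beta> S. s [:monom_eval \<phi> \<alpha>:] (x \<alpha>))"
        by (simp only: scale_sum_right sum_subtractf[symmetric])
          (intro sum.cong refl, simp add: algebra_simps flip: scale_left_diff_distrib)
      then have "(\<Sum>\<alpha>\<in>insert \<beta> S.
          s [:monom_eval \<phi> \<alpha>:] (s [:monom_eval \<psi> \<alpha> - monom_eval \<psi> \<beta>:] (x \<alpha>))) = 0"
        by (simp only: insert.prems(1) scale_zero_right diff_self)
      then show ?thesis
        using insert.hyps by (simp del: scale_scale)
    qed
    \<comment> \<open>The module may have torsion over \<complex>[\<partial>], but a nonzero complex
      constant is a unit.\<close>
    from insert.IH[OF this \<alpha>]
    have "s [:1 / (monom_eval \<psi> \<alpha> - monom_eval \<psi> \<beta>):]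
        (s [:monom_eval \<psi> \<alpha> - monom_eval \<psi> \<beta>:] (x \<alpha>)) = 0"
      by simp
    then show ?thesis using \<psi> by (simp flip: one_pCons)
  qed
  moreover have "x \<beta> = 0"
    using insert.prems(1)[of "\<lambda>_. 1"] insert.hyps S
    by (simp add: monom_eval_def flip: one_pCons)
  ultimately show ?case using insert.prems by auto
qed simp

lemma lpoly_eqI:
  assumes "\<And>\<phi>. eval \<phi> p = eval \<phi> q"
  shows "p = q"
proof -
  have "Poly_Mapping.lookup (p - q) \<alpha> = 0" for \<alpha>
  proof (cases "\<alpha> \<in> Poly_Mapping.keys (p - q)")
    case True
    show ?thesis
    proof (rule monom_eval_independent[OF _ _ True])
      fix \<phi>
      show "(\<Sum>\<alpha>\<in>Poly_Mapping.keys (p - q). s [:monom_eval \<phi> \<alpha>:] (Poly_Mapping.lookup (p - q) \<alpha>)) = 0"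
        using assms[of \<phi>] eval_diff[of \<phi> p q] by (simp add: lpoly_eval_def)
    qed simp
  qed (simp add: in_keys_iff)
  then show ?thesis
    by (simp add: poly_mapping_eq_iff lookup_minus fun_eq_iff)
qed

lemma eval_in_vars_cong:
  assumes "in_vars k p" "\<And>j. j < k \<Longrightarrow> \<phi> j = \<psi> j"
  shows "eval \<phi> p = eval \<psi> p"
  unfolding lpoly_eval_def
proof (intro sum.cong refl)
  fix \<alpha> assume "\<alpha> \<in> Poly_Mapping.keys p"
  then have "Poly_Mapping.keys \<alpha> \<subseteq> {..<k}"
    using assms by (simp add: in_vars_def)
  then have "monom_eval \<phi> \<alpha> = monom_eval \<psi> \<alpha>"
    using assms(2) unfolding monom_eval_def by (intro prod.cong) auto
  then show "s [:monom_eval \<phi> \<alpha>:] (Poly_Mapping.lookup p \<alpha>)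
      = s [:monom_eval \<psi> \<alpha>:] (Poly_Mapping.lookup p \<alpha>)" by simp
qed

text \<open>Setting the variables from \<open>k\<close> on to 1 does not change the value and merges
  the monomials of \<open>p\<close> into their truncations \<open>cut \<alpha>\<close>. By
  \<open>lpoly_eqI\<close> the merged polynomial is \<open>p\<close> itself, and its keys use
  variables below \<open>k\<close>.\<close>

lemma in_varsI:
  assumes "\<And>\<phi> \<psi>. (\<And>j. j < k \<Longrightarrow> \<phi> j = \<psi> j) \<Longrightarrow> eval \<phi> p = eval \<psi> p"
  shows "in_vars k p"
proof -
  define cut where "cut \<alpha> = (\<Sum>j\<in>Poly_Mapping.keys \<alpha> \<inter> {..<k}.
      Poly_Mapping.single j (Poly_Mapping.lookup \<alpha> j))" for \<alpha> :: "nat \<Rightarrow>\<^sub>0 nat"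
  have lookup_cut: "Poly_Mapping.lookup (cut \<alpha>) j = (if j < k then Poly_Mapping.lookup \<alpha> j else 0)" for \<alpha> j
    by (auto simp: cut_def lookup_sum lookup_single when_def in_keys_iff)
  have keys_cut: "Poly_Mapping.keys (cut \<alpha>) \<subseteq> {..<k}" for \<alpha>
    using lookup_cut[of \<alpha>] by (auto simp: in_keys_iff split: if_splits)
  define q where
    "q = (\<Sum>\<alpha>\<in>Poly_Mapping.keys p. Poly_Mapping.single (cut \<alpha>) (Poly_Mapping.lookup p \<alpha>))"
  have "p = q"
  proof (rule lpoly_eqI)
    fix \<phi> :: "nat \<Rightarrow> complex"
    let ?\<psi> = "\<lambda>j. if j < k then \<phi> j else 1"
    have "monom_eval ?\<psi> \<alpha> = monom_eval \<phi> (cut \<alpha>)" for \<alpha>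
    proof -
      have "monom_eval ?\<psi> \<alpha>
          = (\<Prod>j\<in>Poly_Mapping.keys \<alpha> \<union> {..<k}. ?\<psi> j ^ Poly_Mapping.lookup \<alpha> j)"
        by (rule monom_eval_superset) auto
      also have "\<dots> = (\<Prod>j\<in>{..<k}. \<phi> j ^ Poly_Mapping.lookup (cut \<alpha>) j)"
        by (rule prod.mono_neutral_cong_right) (auto simp: lookup_cut)
      also have "\<dots> = monom_eval \<phi> (cut \<alpha>)"
        by (rule monom_eval_superset[symmetric]) (simp_all add: keys_cut)
      finally show ?thesis .
    qed
    then have "eval ?\<psi> p = eval \<phi> q"
      by (simp add: q_def lpoly_eval_def[of s ?\<psi>])
    moreover have "eval \<phi> p = eval ?\<psi> p"
      by (rule assms) simp
    ultimately show "eval \<phi> p = eval \<phi> q" by simp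
  qed
  then have "Poly_Mapping.keys p \<subseteq> (\<Union>\<alpha>\<in>Poly_Mapping.keys p.
      Poly_Mapping.keys (Poly_Mapping.single (cut \<alpha>) (Poly_Mapping.lookup p \<alpha>)))"
    unfolding q_def by (metis keys_sum)
  then show ?thesis
    using keys_cut unfolding in_vars_def by (fastforce split: if_splits)
qed

end

section \<open>The coefficient ring as a module over itself\<close>

interpretation CP: poly_module "(*) :: complex poly \<Rightarrow> _"
  by unfold_locales (simp_all add: algebra_simps)

text \<open>Through this identification \<open>eval_lsmult\<close> makes \<open>reval\<close>
  multiplicative.\<close>

lemma lsmult_mult: "lsmult (*) r p = (r * p :: complex poly lpoly)"
proof -
  have "r * p = (\<Sum>\<alpha>\<in>Poly_Mapping.keys r. Poly_Mapping.single \<alpha> (Poly_Mapping.lookup r \<alpha>))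
      * (\<Sum>\<alpha>\<in>Poly_Mapping.keys p. Poly_Mapping.single \<alpha> (Poly_Mapping.lookup p \<alpha>))"
    using poly_mapping_sum_single[of "Poly_Mapping.keys r" r]
      poly_mapping_sum_single[of "Poly_Mapping.keys p" p] by simp
  then show ?thesis by (simp add: lsmult_def sum_product mult_single)
qed

abbreviation "reval \<equiv> lpoly_eval ((*) :: complex poly \<Rightarrow> _)"

lemma reval_mult [simp]: "reval \<phi> (r * p) = reval \<phi> r * reval \<phi> p"
  by (simp flip: lsmult_mult)

lemma reval_1 [simp]: "reval \<phi> 1 = 1"
  using CP.eval_lconst[of \<phi> 1] by (simp add: lconst_def)

lemma reval_power [simp]: "reval \<phi> (r ^ k) = reval \<phi> r ^ k"
  by (induction k) auto

lemma reval_prod [simp]: "reval \<phi> (prod f I) = (\<Prod>i\<in>I. reval \<phi> (f i))"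
  by (induction I rule: infinite_finite_induct) auto

lemma reval_lam [simp]: "reval \<phi> (lam i) = [:\<phi> i:]"
  by (simp add: lam_def)

lemma reval_dsym [simp]: "reval \<phi> dsym = [:0, 1:]"
  by (simp add: dsym_def)

lemma const_prod: "(\<Prod>i\<in>I. [:f i:]) = [:\<Prod>i\<in>I. f i :: complex:]"
  by (induction I rule: infinite_finite_induct) (auto simp: one_pCons)

lemma const_sum: "(\<Sum>i\<in>I. [:f i:]) = [:\<Sum>i\<in>I. f i :: complex:]"
  by (induction I rule: infinite_finite_induct) auto

lemma const_minus_one_power: "(- 1) ^ i = [:(- 1) ^ i :: complex:]"
  by (metis poly_const_pow minus_pCons minus_zero one_pCons)

context poly_module
begin

text \<open>The substitutes have to evaluate to constants free of \<partial>, so that the result is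
  again a value at an assignment. The bound \<open>k\<close> matters because \<open>Ls ! j\<close>
  is unspecified past the end of a parameter list.\<close>

lemma eval_subst:
  assumes "in_vars k p" "\<And>j. j < k \<Longrightarrow> reval \<phi> (\<sigma> j) = [:\<psi> j:]"
  shows "eval \<phi> (subst s \<sigma> p) = eval \<psi> p"
proof -
  have "reval \<phi> (\<Prod>j\<in>Poly_Mapping.keys \<alpha>. \<sigma> j ^ Poly_Mapping.lookup \<alpha> j) = [:monom_eval \<psi> \<alpha>:]"
    if "\<alpha> \<in> Poly_Mapping.keys p" for \<alpha>
  proof -
    have "Poly_Mapping.keys \<alpha> \<subseteq> {..<k}"
      using assms(1) that by (simp add: in_vars_def)
    then show ?thesis
      using assms(2) by (auto simp: monom_eval_def poly_const_pow subset_iff simp flip: const_prod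
          intro!: prod.cong)
  qed
  then show ?thesis
    by (simp add: subst_def lpoly_eval_def[of s \<psi>] del: reval_prod)
qed

lemma eval_ev [simp]: "eval \<phi> (ev s L x) = cpoly_eval s (reval \<phi> L) x"
  by (simp add: ev_def cpoly_eval_def)

text \<open>Monomials evaluate to complex constants, and over those the evaluated \<open>f\<close>
  is linear even where it twists \<partial>, as the products do.\<close>

lemma eval_ext:
  assumes "module sA"
    and "\<And>c x y. eval \<phi> (f (sA [:c:] x + y)) = s [:c:] (eval \<phi> (f x)) + eval \<phi> (f y)"
  shows "eval \<phi> (ext s f p) = eval \<phi> (f (lpoly_eval sA \<phi> p))"
proof -
  interpret A: module sA by fact
  have 0: "eval \<phi> (f 0) = 0"
    using assms(2)[of 1 0 0] by (simp flip: one_pCons)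
  have "eval \<phi> (f (\<Sum>\<alpha>\<in>I. sA [:monom_eval \<phi> \<alpha>:] (Poly_Mapping.lookup p \<alpha>)))
      = (\<Sum>\<alpha>\<in>I. s [:monom_eval \<phi> \<alpha>:] (eval \<phi> (f (Poly_Mapping.lookup p \<alpha>))))" for I
    by (induction I rule: infinite_finite_induct) (simp_all add: 0 assms(2))
  then show ?thesis
    by (simp add: ext_def lpoly_eval_def[of sA])
qed

lemma cpoly_eval_superset:
  "degree x \<le> N \<Longrightarrow> cpoly_eval s z x = (\<Sum>k\<le>N. s (z ^ k) (coeff x k))"
  unfolding cpoly_eval_def by (intro sum.mono_neutral_left) (auto simp: coeff_eq_0)

lemma cpoly_eval_add [simp]: "cpoly_eval s z (x + y) = cpoly_eval s z x + cpoly_eval s z y"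
proof -
  let ?N = "max (degree x) (degree y)"
  have "degree (x + y) \<le> ?N" by (simp add: degree_add_le)
  then show ?thesis
    by (simp add: cpoly_eval_superset[of _ ?N] scale_right_distrib sum.distrib)
qed

lemma cpoly_eval_scale [simp]:
  "cpoly_eval s z (map_poly (s q) x) = s q (cpoly_eval s z x)"
  by (simp add: cpoly_eval_superset[of _ "degree x"] map_poly_degree_leq coeff_map_poly
      scale_sum_right mult.commute)

end

text \<open>Horner's scheme: \<open>r\<close> is what \<partial> turns into when pulled out of
  \<open>f\<close>, in the uses either a number -l or the operator \<partial>+l.\<close>

lemma polynomial_linear_extend:
  assumes "module sA" "module sM"
    and add: "\<And>x y. f (x + y) = f x + f y"
    and const: "\<And>c x. f (sA [:c:] x) = sM [:c:] (f x)"
    and dpart: "\<And>x. f (dpart sA x) = sM r (f x)"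
  shows "f (sA q x) = sM (pcompose q r) (f x)"
proof (induction q arbitrary: x)
  case 0
  then show ?case
    using const[of 0 x] by simp
next
  case (pCons c q)
  interpret A: module sA by fact
  interpret M: module sM by fact
  have "pCons c q = [:c:] + [:0, 1:] * q" by simp
  then have "f (sA (pCons c q) x) = f (sA [:c:] x + dpart sA (sA q x))"
    by (simp only: A.scale_left_distrib A.scale_scale)
  also have "\<dots> = sM [:c:] (f x) + sM (r * pcompose q r) (f x)"
    by (simp add: add const dpart pCons.IH del: A.scale_scale)
  also have "\<dots> = sM (pcompose (pCons c q) r) (f x)"
    by (simp add: pcompose_pCons flip: M.scale_left_distrib)
  finally show ?case .
qed


section \<open>The differential of a graded Lie algebra representation\<close>

lemma omit_0 [simp]: "omit 0 (x # xs) = xs"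
  by (simp add: omit_def)

lemma omit_Suc [simp]: "omit (Suc i) (x # xs) = x # omit i xs"
  by (simp add: omit_def)

lemma omit2_0_Suc [simp]: "omit2 0 (Suc j) (x # xs) = omit j xs"
  by (simp add: omit2_def)

lemma omit2_Suc_Suc [simp]: "omit2 (Suc i) (Suc j) (x # xs) = x # omit2 i j xs"
  by (simp add: omit2_def)

text \<open>A pair \<open>(l, a)\<close> is the element \<open>a\<close> placed in degree \<open>l \<in> \<complex>\<close>, where \<open>\<partial>\<close> acts as \<open>-l\<close>;
  \<open>W m\<close> is the part of degree \<open>m\<close> of the representation.\<close>
locale graded_lie_representation =
  module sA + V: vector_space sV
  for sA :: "complex poly \<Rightarrow> 'a::ab_group_add \<Rightarrow> 'a"
    and sV :: "complex \<Rightarrow> 'v::ab_group_add \<Rightarrow> 'v" +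
  fixes br :: "complex \<Rightarrow> complex \<Rightarrow> 'a \<Rightarrow> 'a \<Rightarrow> 'a"
    and act :: "complex \<Rightarrow> 'a \<Rightarrow> 'v \<Rightarrow> 'v"
    and H :: "'v set"
    and W :: "complex \<Rightarrow> 'v set"
  assumes br_antisym: "br m l b a = - br l m a b"
    and br_jacobi: "br l (m + k) a (br m k b c) = br (l + m) k (br l m a b) c + br m (l + k) b (br l k a c)"
    and br_right: "(\<And>q x y. f (sA q x + y) = sV (poly q (- (l + m))) (f x) + f y) \<Longrightarrow>
        f (br l m a (sA q b + b')) = sV (poly q (- m)) (f (br l m a b)) + f (br l m a b')"
    and act_linear: "act l a (sV r F + F') = sV r (act l a F) + act l a F'"
    and act_slot: "F \<in> H \<Longrightarrow> act l (sA q a + b) F = sV (poly q (- l)) (act l a F) + act l b F"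
    and act_br: "F \<in> H \<Longrightarrow>
        act (l + m) (br l m a b) F = act l a (act m b F) - act m b (act l a F)"
    and H_0: "0 \<in> H" and H_linear: "F \<in> H \<Longrightarrow> F' \<in> H \<Longrightarrow> sV r F + F' \<in> H"
    and H_act: "F \<in> H \<Longrightarrow> act l a F \<in> H"
    and W_0: "0 \<in> W m" and W_linear: "F \<in> W m \<Longrightarrow> F' \<in> W m \<Longrightarrow> sV r F + F' \<in> W m"
    and W_act: "F \<in> W m \<Longrightarrow> act l a F \<in> W (l + m)"
begin

section \<open>Sesquilinear and alternating maps on lists of graded elements\<close>

definition ad :: "complex \<times> 'a \<Rightarrow> complex \<times> 'a \<Rightarrow> complex \<times> 'a" where
  "ad x y = (fst x + fst y, br (fst x) (fst y) (snd x) (snd y))"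

definition slot_linear :: "((complex \<times> 'a) list \<Rightarrow> 'v) \<Rightarrow> bool" where
  "slot_linear G \<longleftrightarrow> (\<forall>u v l q a b. G (u @ (l, sA q a + b) # v)
     = sV (poly q (- l)) (G (u @ (l, a) # v)) + G (u @ (l, b) # v))"

text \<open>Adjacent exchanges on lists of any length suit inductions that contract with the head;
  distant exchanges follow in \<open>alternating_swap\<close>.\<close>

definition alternating :: "((complex \<times> 'a) list \<Rightarrow> 'v) \<Rightarrow> bool" where
  "alternating G \<longleftrightarrow> (\<forall>u x y v. G (u @ x # y # v) = - G (u @ y # x # v))"

text \<open>The derivation that extends \<open>ad x\<close> to lists. Each bracket stays in the
  place of its argument, so no signs occur.\<close>

fun ad_sum :: "complex \<times> 'a \<Rightarrow> ((complex \<times> 'a) list \<Rightarrow> 'v) \<Rightarrow> (complex \<times> 'a) list \<Rightarrow> 'v" where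
  "ad_sum x G [] = 0"
| "ad_sum x G (y # ps) = G (ad x y # ps) + ad_sum x (\<lambda>qs. G (y # qs)) ps"

definition lie_deriv :: "complex \<times> 'a \<Rightarrow> ((complex \<times> 'a) list \<Rightarrow> 'v) \<Rightarrow> (complex \<times> 'a) list \<Rightarrow> 'v" where
  "lie_deriv x G ps = act (fst x) (snd x) (G ps) - ad_sum x G ps"

text \<open>The recursion is Cartan's formula: contraction with \<open>x\<close> anticommutes with the differential
  up to the Lie derivative along \<open>x\<close>.\<close>
fun differential :: "((complex \<times> 'a) list \<Rightarrow> 'v) \<Rightarrow> (complex \<times> 'a) list \<Rightarrow> 'v" where
  "differential G [] = 0"
| "differential G (x # ps) = lie_deriv x G ps - differential (\<lambda>qs. G (x # qs)) ps"

lemma slot_linearD: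
  "slot_linear G \<Longrightarrow> G (u @ (l, sA q a + b) # v)
     = sV (poly q (- l)) (G (u @ (l, a) # v)) + G (u @ (l, b) # v)"
  by (simp add: slot_linear_def)

lemma slot_linear_Cons: "slot_linear G \<Longrightarrow> slot_linear (\<lambda>qs. G (x # qs))"
  using slot_linearD[of G "x # _"] by (simp add: slot_linear_def)

lemma slot_linear_Cons_arg:
  "slot_linear G \<Longrightarrow>
    G ((l, sA q a + b) # v) = sV (poly q (- l)) (G ((l, a) # v)) + G ((l, b) # v)"
  using slot_linearD[of G "[]"] by simp

lemma slot_linear_add:
  "slot_linear G \<Longrightarrow> G ((l, a + b) # v) = G ((l, a) # v) + G ((l, b) # v)"
  using slot_linear_Cons_arg[of G l 1 a b] by simp

lemma slot_linear_uminus: "slot_linear G \<Longrightarrow> G ((l, - a) # v) = - G ((l, a) # v)"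
  using slot_linear_add[of G l "- a" a v] slot_linear_Cons_arg[of G l 0 0 0 v]
    slot_linear_add[of G l 0 0 v] by (simp add: eq_neg_iff_add_eq_0)

text \<open>The slot of degree \<open>fst x + l\<close> that receives the bracket treats \<partial>
  as a number, which is the hypothesis of \<open>br_right\<close>.\<close>

lemma slot_linear_ad_right:
  assumes "slot_linear G"
  shows "G (ad x (l, sA q a + b) # v)
    = sV (poly q (- l)) (G (ad x (l, a) # v)) + G (ad x (l, b) # v)"
  using br_right[of "\<lambda>c. G ((fst x + l, c) # v)" "fst x" l "snd x" q a b]
    slot_linear_Cons_arg[OF assms] by (simp add: ad_def)

lemma slot_linear_ad_swap: "slot_linear G \<Longrightarrow> G (ad y x # v) = - G (ad x y # v)"
  unfolding ad_def fst_conv snd_conv br_antisym[of "fst y" "fst x" "snd y" "snd x"]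
    add.commute[of "fst y" "fst x"]
  by (rule slot_linear_uminus)

lemma slot_linear_ad_left:
  assumes "slot_linear G"
  shows "G (ad (l, sA q a + b) x # v)
    = sV (poly q (- l)) (G (ad (l, a) x # v)) + G (ad (l, b) x # v)"
proof -
  have swap: "G (ad (l, c) x # v) = - G (ad x (l, c) # v)" for c
    by (rule slot_linear_ad_swap[OF assms])
  show ?thesis
    using slot_linear_ad_right[OF assms, of x l q a b v] by (simp add: swap)
qed

lemma alternatingD: "alternating G \<Longrightarrow> G (u @ x # y # v) = - G (u @ y # x # v)"
  unfolding alternating_def by blast

lemma alternating_Cons:
  assumes "alternating G"
  shows "alternating (\<lambda>qs. G (x # qs))"
  unfolding alternating_def
proof (intro allI)
  fix u y z v
  show "G (x # u @ y # z # v) = - G (x # u @ z # y # v)"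
    using alternatingD[OF assms, of "x # u" y z v] by simp
qed

text \<open>The exchange across \<open>z # w\<close> is the exchange across \<open>w\<close>
  conjugated by adjacent ones: three signs in all.\<close>

lemma alternating_swap:
  "alternating G \<Longrightarrow> G (u @ x # w @ y # v) = - G (u @ y # w @ x # v)"
proof (induction w arbitrary: u)
  case Nil
  then show ?case using alternatingD[of G u x y v] by simp
next
  case (Cons z w)
  have "G (u @ x # (z # w) @ y # v) = - G ((u @ [z]) @ x # w @ y # v)"
    using alternatingD[OF Cons.prems, of u x z "w @ y # v"] by simp
  also have "\<dots> = G (u @ z # y # w @ x # v)"
    using Cons.IH[OF Cons.prems, of "u @ [z]"] by simp
  also have "\<dots> = - G (u @ y # (z # w) @ x # v)"
    using alternatingD[OF Cons.prems, of u z y "w @ x # v"] by simp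
  finally show ?case .
qed

section \<open>Cartan calculus and the square of the differential\<close>

lemma ad_sum_linear:
  "ad_sum x (\<lambda>qs. sV c (F qs) + G qs) ps = sV c (ad_sum x F ps) + ad_sum x G ps"
  by (induction ps arbitrary: F G) (simp_all add: V.scale_right_distrib algebra_simps)

lemma lie_deriv_linear:
  "lie_deriv x (\<lambda>qs. sV c (F qs) + G qs) ps = sV c (lie_deriv x F ps) + lie_deriv x G ps"
  by (simp add: lie_deriv_def act_linear ad_sum_linear V.scale_right_diff_distrib)

lemma differential_linear:
  "differential (\<lambda>qs. sV c (F qs) + G qs) ps = sV c (differential F ps) + differential G ps"
  by (induction ps arbitrary: F G)
    (simp_all add: lie_deriv_linear V.scale_right_diff_distrib)

lemma act_0: "act l a 0 = 0"
  using act_linear[of l a 1 0 0] by simp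

lemma linear_diff:
  assumes "\<And>c (F :: 'b \<Rightarrow> 'v) G. T (\<lambda>qs. sV c (F qs) + G qs) = sV c (T F) + (T G :: 'v)"
  shows "T (\<lambda>qs. F qs - G qs) = T F - T G"
  using assms[of "- 1" G F] by simp

lemma lie_deriv_diff: "lie_deriv x (\<lambda>qs. F qs - G qs) ps = lie_deriv x F ps - lie_deriv x G ps"
  by (rule linear_diff) (rule lie_deriv_linear)

lemma differential_diff: "differential (\<lambda>qs. F qs - G qs) ps = differential F ps - differential G ps"
  by (rule linear_diff) (rule differential_linear)

text \<open>Cartan's relation between Lie derivative and contraction; it lets the inductions below
  pass to contracted maps on shorter lists.\<close>

lemma lie_deriv_Cons:
  "lie_deriv x G (y # ps) = lie_deriv x (\<lambda>qs. G (y # qs)) ps - G (ad x y # ps)"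
  by (simp add: lie_deriv_def)

text \<open>On the empty list this is \<open>act_br\<close>, hence the condition on
  \<open>H\<close>. Contraction with \<open>z\<close> leaves brackets of \<open>z\<close> with
  \<open>x\<close> and \<open>y\<close>, which the Jacobi identity recombines.\<close>

lemma lie_deriv_ad:
  assumes "slot_linear G" "\<And>ps. G ps \<in> H"
  shows "lie_deriv (ad x y) G ps
    = lie_deriv x (lie_deriv y G) ps - lie_deriv y (lie_deriv x G) ps"
  using assms
proof (induction ps arbitrary: G)
  case Nil
  then show ?case by (simp add: lie_deriv_def ad_def act_br)
next
  case (Cons z ps)
  \<comment> \<open>Additivity in a slot needs the three double brackets written in literally the
    same degree.\<close>
  have "ad x (ad y z)
      = (fst (ad (ad x y) z), snd (ad (ad x y) z) + snd (ad y (ad x z)))"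
    by (simp add: ad_def add.assoc
        br_jacobi[of "fst x" "fst y" "fst z" "snd x" "snd y" "snd z"])
  moreover have "ad y (ad x z) = (fst (ad (ad x y) z), snd (ad y (ad x z)))"
    by (simp add: ad_def add.left_commute add.assoc)
  ultimately have jacobi: "G (ad x (ad y z) # ps) = G (ad (ad x y) z # ps) + G (ad y (ad x z) # ps)"
    using slot_linear_add[OF Cons.prems(1), of "fst (ad (ad x y) z)" "snd (ad (ad x y) z)"
      "snd (ad y (ad x z))" ps] unfolding prod.collapse by argo
  show ?case
    using Cons.IH[OF slot_linear_Cons[OF Cons.prems(1)], of z] Cons.prems(2)
    by (simp add: lie_deriv_Cons lie_deriv_diff jacobi)
qed

text \<open>After contraction with \<open>y\<close> the induction hypothesis settles the shorter
  list, and the remaining double Lie derivatives combine by \<open>lie_deriv_ad\<close>.\<close>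

lemma differential_lie_deriv:
  assumes "slot_linear G" "\<And>ps. G ps \<in> H"
  shows "differential (lie_deriv x G) ps = lie_deriv x (differential G) ps"
  using assms
proof (induction ps arbitrary: G)
  case Nil
  then show ?case by (simp add: lie_deriv_def act_0)
next
  case (Cons y ps)
  show ?case
    using Cons.IH[OF slot_linear_Cons[OF Cons.prems(1)], of y] Cons.prems(2)
    by (simp add: lie_deriv_Cons lie_deriv_diff differential_diff lie_deriv_ad[OF Cons.prems])
qed

text \<open>Contraction of d d with \<open>x\<close> is \<theta> d - d \<theta> + d d \<iota>: the
  first two terms cancel, the last vanishes by induction.\<close>

theorem differential_squared:
  assumes "slot_linear G" "\<And>ps. G ps \<in> H"
  shows "differential (differential G) ps = 0"
  using assms
proof (induction ps arbitrary: G)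
  case (Cons x ps)
  show ?case
    using Cons.IH[OF slot_linear_Cons[OF Cons.prems(1)], of x] Cons.prems(2)
    by (simp add: differential_diff differential_lie_deriv[OF Cons.prems])
qed simp

section \<open>Skew symmetry of the differential\<close>

lemma ad_sum_alternating:
  assumes "alternating G"
  shows "alternating (ad_sum x G)"
proof -
  have "ad_sum x G (u @ y # z # v) = - ad_sum x G (u @ z # y # v)" for u y z v
    using assms
  proof (induction u arbitrary: G)
    case Nil
    note alt = alternatingD[OF Nil, of "[]", simplified]
    have "ad_sum x (\<lambda>qs. G (y # z # qs)) v = - ad_sum x (\<lambda>qs. G (z # y # qs)) v"
      \<comment> \<open>The instance with two zero maps reads v = v + v and shows that
        \<open>ad_sum\<close> of the zero map is 0.\<close>
      using ad_sum_linear[of x "- 1" "\<lambda>qs. G (z # y # qs)" "\<lambda>_. 0" v]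
        ad_sum_linear[of x 1 "\<lambda>_. 0" "\<lambda>_. 0" v]
      by (simp add: alt[of y z])
    then show ?case
      using alt[of "ad x y" z v] alt[of y "ad x z" v] by simp
  next
    case (Cons w u)
    show ?case
      using alternatingD[OF Cons.prems, of "ad x w # u" y z v]
        Cons.IH[OF alternating_Cons[OF Cons.prems], of w]
      by (simp only: ad_sum.simps append_Cons minus_add_distrib)
  qed
  then show ?thesis
    unfolding alternating_def by blast
qed

lemma act_uminus: "act l a (- F) = - act l a F"
  using act_linear[of l a "- 1" F 0] by (simp add: act_0)

lemma lie_deriv_alternating:
  assumes "alternating G"
  shows "alternating (lie_deriv x G)"
  unfolding alternating_def lie_deriv_def
proof (intro allI)
  fix u y z v
  show "act (fst x) (snd x) (G (u @ y # z # v)) - ad_sum x G (u @ y # z # v)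
      = - (act (fst x) (snd x) (G (u @ z # y # v)) - ad_sum x G (u @ z # y # v))"
    using alternatingD[OF assms, of u y z v]
      alternatingD[OF ad_sum_alternating[OF assms], of x u y z v]
    by (simp add: act_uminus)
qed

text \<open>Two steps of the recursion leave a difference of Lie derivatives, the term
  \<open>- G (ad x y # v)\<close> and the differential of a doubly contracted map. Each of the three
  changes sign when \<open>x\<close> and \<open>y\<close> are exchanged.\<close>

lemma differential_alternating:
  assumes "alternating G" "slot_linear G"
  shows "alternating (differential G)"
proof -
  have "differential G (u @ x # y # v) = - differential G (u @ y # x # v)" for u x y v
    using assms
  proof (induction u arbitrary: G)
    case Nil
    have "differential (\<lambda>qs. G (y # x # qs)) v = - differential (\<lambda>qs. G (x # y # qs)) v"
      using differential_linear[of "- 1" "\<lambda>qs. G (x # y # qs)" "\<lambda>_. 0" v]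
        differential_linear[of 1 "\<lambda>_. 0" "\<lambda>_. 0" v] alternatingD[OF Nil(1), of "[]" y x]
      by simp
    then show ?case
      by (simp add: lie_deriv_Cons slot_linear_ad_swap[OF Nil(2), of x y])
  next
    case (Cons w u)
    show ?case
      using alternatingD[OF lie_deriv_alternating[OF Cons.prems(1)], of w u x y v]
        Cons.IH[OF alternating_Cons[OF Cons.prems(1)] slot_linear_Cons[OF Cons.prems(2)], of w]
      by (simp only: differential.simps append_Cons minus_diff_minus)
  qed
  then show ?thesis unfolding alternating_def by blast
qed

section \<open>Stability of coefficients, degree and sesquilinearity\<close>

lemma H_diff: "F \<in> H \<Longrightarrow> F' \<in> H \<Longrightarrow> F - F' \<in> H"
  using H_linear[of F' F "- 1"] by simp

lemma ad_sum_in_H: "(\<And>ps. G ps \<in> H) \<Longrightarrow> ad_sum x G ps \<in> H"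
  using H_linear[of _ _ 1] by (induction ps arbitrary: G) (simp_all add: H_0)

lemma differential_in_H: "(\<And>ps. G ps \<in> H) \<Longrightarrow> differential G ps \<in> H"
  by (induction ps arbitrary: G) (simp_all add: H_0 H_diff H_act lie_deriv_def ad_sum_in_H)

lemma W_diff: "F \<in> W m \<Longrightarrow> F' \<in> W m \<Longrightarrow> F - F' \<in> W m"
  using W_linear[of F' m F "- 1"] by simp

text \<open>The offset \<open>d\<close> collects the degrees of the arguments already
  contracted.\<close>

lemma ad_sum_graded:
  "(\<And>qs. G qs \<in> W (d + sum_list (map fst qs))) \<Longrightarrow>
    ad_sum x G ps \<in> W (fst x + (d + sum_list (map fst ps)))"
proof (induction ps arbitrary: G d)
  case (Cons y ps)
  have "G (ad x y # ps) \<in> W (fst x + (d + sum_list (map fst (y # ps))))"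
    using Cons.prems[of "ad x y # ps"] by (simp add: ad_def algebra_simps)
  moreover have "ad_sum x (\<lambda>qs. G (y # qs)) ps \<in> W (fst x + (d + sum_list (map fst (y # ps))))"
    using Cons.IH[of "\<lambda>qs. G (y # qs)" "d + fst y"] Cons.prems[of "y # _"]
    by (simp add: algebra_simps)
  ultimately show ?case
    using W_linear[of _ _ _ 1] by simp
qed (simp add: W_0)

lemma differential_graded:
  "(\<And>qs. G qs \<in> W (d + sum_list (map fst qs))) \<Longrightarrow>
    differential G ps \<in> W (d + sum_list (map fst ps))"
proof (induction ps arbitrary: G d)
  case (Cons x ps)
  have "lie_deriv x G ps \<in> W (d + sum_list (map fst (x # ps)))"
    using W_diff[OF W_act[OF Cons.prems] ad_sum_graded[of G d x ps], OF Cons.prems]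
    by (simp add: lie_deriv_def algebra_simps)
  moreover have "differential (\<lambda>qs. G (x # qs)) ps \<in> W (d + sum_list (map fst (x # ps)))"
    using Cons.IH[of "\<lambda>qs. G (x # qs)" "d + fst x"] Cons.prems[of "x # _"]
    by (simp add: algebra_simps)
  ultimately show ?case by (simp add: W_diff)
qed (simp add: W_0)

lemma ad_sum_slot_linear:
  assumes "slot_linear G"
  shows "slot_linear (ad_sum x G)"
proof -
  have "ad_sum x G (u @ (l, sA q a + b) # v)
      = sV (poly q (- l)) (ad_sum x G (u @ (l, a) # v)) + ad_sum x G (u @ (l, b) # v)" for u v l q a b
    using assms
  proof (induction u arbitrary: G)
    case Nil
    then show ?case
      by (simp add: slot_linear_ad_right slot_linear_Cons_arg ad_sum_linear
          V.scale_right_distrib)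
  next
    case (Cons y u)
    show ?case
      using Cons.IH[OF slot_linear_Cons[OF Cons.prems], of y]
        slot_linearD[OF Cons.prems, of "ad x y # u"]
      by (simp add: V.scale_right_distrib)
  qed
  then show ?thesis by (simp add: slot_linear_def)
qed

lemma lie_deriv_slot_linear:
  assumes "slot_linear G"
  shows "slot_linear (lie_deriv x G)"
  unfolding slot_linear_def
  by (simp add: lie_deriv_def slot_linearD[OF assms] act_linear
      slot_linearD[OF ad_sum_slot_linear[OF assms]] V.scale_right_diff_distrib)

lemma ad_sum_slot:
  "slot_linear G \<Longrightarrow>
    ad_sum (l, sA q a + b) G ps = sV (poly q (- l)) (ad_sum (l, a) G ps) + ad_sum (l, b) G ps"
  by (induction ps arbitrary: G)
    (simp_all add: slot_linear_Cons slot_linear_ad_left V.scale_right_distrib)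

lemma lie_deriv_slot:
  "slot_linear G \<Longrightarrow> G ps \<in> H \<Longrightarrow> lie_deriv (l, sA q a + b) G ps
     = sV (poly q (- l)) (lie_deriv (l, a) G ps) + lie_deriv (l, b) G ps"
  by (simp add: lie_deriv_def ad_sum_slot act_slot V.scale_right_diff_distrib)

lemma differential_slot_linear:
  assumes "slot_linear G" "\<And>ps. G ps \<in> H"
  shows "slot_linear (differential G)"
proof -
  have "differential G (u @ (l, sA q a + b) # v)
      = sV (poly q (- l)) (differential G (u @ (l, a) # v)) + differential G (u @ (l, b) # v)" for u v l q a b
    using assms
  proof (induction u arbitrary: G)
    case Nil
    then show ?case
      by (simp add: lie_deriv_slot slot_linear_Cons_arg differential_linear V.scale_right_diff_distrib)
  next
    case (Cons y u)
    show ?case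
      using Cons.IH[OF slot_linear_Cons[OF Cons.prems(1)], of y] Cons.prems(2)
        slot_linearD[OF lie_deriv_slot_linear[OF Cons.prems(1)], of y u]
      by (simp add: V.scale_right_diff_distrib)
  qed
  then show ?thesis by (simp add: slot_linear_def)
qed

text \<open>Moving the bracket from place \<open>j\<close> to the front crosses \<open>j\<close>
  arguments, whence the sign.\<close>

lemma ad_sum_eq:
  "alternating G \<Longrightarrow>
    ad_sum x G ps = (\<Sum>j<length ps. sV ((- 1) ^ j) (G (ad x (ps ! j) # omit j ps)))"
proof (induction ps arbitrary: G)
  case (Cons y ps)
  have "(\<Sum>j<length ps. sV ((- 1) ^ j) (G (y # ad x (ps ! j) # omit j ps)))
      = (\<Sum>j<length ps. sV ((- 1) ^ Suc j) (G (ad x (ps ! j) # y # omit j ps)))"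
  proof (rule sum.cong[OF refl])
    fix j
    show "sV ((- 1) ^ j) (G (y # ad x (ps ! j) # omit j ps))
        = sV ((- 1) ^ Suc j) (G (ad x (ps ! j) # y # omit j ps))"
      using alternatingD[OF Cons.prems, of "[]" y "ad x (ps ! j)" "omit j ps"] by simp
  qed
  then show ?case
    using Cons.IH[OF alternating_Cons[OF Cons.prems], of y]
    by (simp only: ad_sum.simps length_Cons sum.lessThan_Suc_shift nth_Cons_0 nth_Cons_Suc
        omit_0 omit_Suc power_0 V.scale_one)
qed simp

text \<open>Unfolds Cartan's recursion into the shape of the coboundary, where the bracket always
  stands first. Terms involving index 0 come from the Lie derivative along the head, the others from
  induction.\<close>

lemma differential_eq:
  "alternating G \<Longrightarrow>
    differential G ps = (\<Sum>i<length ps. sV ((- 1) ^ i) (act (fst (ps ! i)) (snd (ps ! i)) (G (omit i ps))))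
      + (\<Sum>j<length ps. \<Sum>i<j. sV ((- 1) ^ (i + j)) (G (ad (ps ! i) (ps ! j) # omit2 i j ps)))"
proof (induction ps arbitrary: G)
  case (Cons x ps)
  \<comment> \<open>In the contracted map \<open>x\<close> precedes the bracket; the exchange
    cancels the minus sign of the recursion.\<close>
  have swap: "G (ad y z # x # v) = - G (x # ad y z # v)" for y z v
    using alternatingD[OF Cons.prems, of "[]" "ad y z" x v] by simp
  show ?case
    using Cons.IH[OF alternating_Cons[OF Cons.prems], of x]
    by (simp add: sum.lessThan_Suc_shift lie_deriv_def ad_sum_eq[OF Cons.prems] sum_negf swap
        sum.distrib sum_subtractf algebra_simps del: sum.lessThan_Suc)
qed simp

end


section \<open>The Lie algebra representation of a conformal module\<close>

context poly_module
begin

lemma vector_space_const: "vector_space (\<lambda>c. s [:c:])"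
proof unfold_locales
  fix a b and x y :: 'm
  show "s [:a:] (x + y) = s [:a:] x + s [:a:] y"
    by (rule scale_right_distrib)
  show "s [:a + b:] x = s [:a:] x + s [:b:] x"
    using scale_left_distrib[of "[:a:]" "[:b:]" x] by simp
  show "s [:a:] (s [:b:] x) = s [:a * b:] x"
    by (simp add: mult.commute)
  show "s [:1:] x = x"
    by (simp flip: one_pCons)
qed

text \<open>Where \<partial> acts as the number \<open>r\<close>, a substituted polynomial in
  \<partial> matters only through its value at \<open>r\<close>.\<close>

lemma cpoly_eval_slot:
  assumes V: "vector_space sV"
    and f: "\<And>q x y. f (s q x + y) = sV (poly q r) (f x) + (f y :: 'v::ab_group_add)"
    and z: "poly z r = poly z' r"
  shows "f (cpoly_eval s z x) = f (cpoly_eval s z' x)"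
proof -
  interpret V: vector_space sV by fact
  have 0: "f 0 = 0" using f[of 1 0 0] by simp
  have "f (cpoly_eval s z x) = (\<Sum>k\<le>degree x. sV (poly z r ^ k) (f (coeff x k)))" for z
  proof -
    have "f (\<Sum>k\<in>I. s (z ^ k) (coeff x k)) = (\<Sum>k\<in>I. sV (poly z r ^ k) (f (coeff x k)))" for I
      by (induction I rule: infinite_finite_induct) (simp_all add: 0 f poly_power)
    then show ?thesis by (simp add: cpoly_eval_def)
  qed
  then show ?thesis using z by simp
qed

end

lemma additive_diff:
  assumes f: "\<And>q x y. f (s q x + y) = t q (f x) + (f y :: 'y::ab_group_add)"
    and "module s" "\<And>y. t 1 y = y"
  shows "f (x - y) = f x - f y"
proof -
  interpret s: module s by fact
  show ?thesis
    using f[of 1 "x - y" y] assms(3) by simp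
qed

lemma lam_product_eval:
  assumes "module sA" "module sB" "module sC" and m: "lam_product sA sB sC m"
  shows lam_product_eval_left:
      "cpoly_eval sC [:l:] (m (sA q a + a') b)
        = sC [:poly q (- l):] (cpoly_eval sC [:l:] (m a b)) + cpoly_eval sC [:l:] (m a' b)"
    and lam_product_eval_right:
      "cpoly_eval sC [:l:] (m a (sB q b + b'))
        = sC (pcompose q [:l, 1:]) (cpoly_eval sC [:l:] (m a b)) + cpoly_eval sC [:l:] (m a b')"
proof -
  interpret C: poly_module sC
    using assms(3) by (simp add: poly_module_def)
  have left: "m (a + a') b = m a b + m a' b" "m (sA [:c:] a) b = map_poly (sC [:c:]) (m a b)"
    and right: "m a (b + b') = m a b + m a b'" "m a (sB [:c:] b) = map_poly (sC [:c:]) (m a b)"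
    for a a' b b' c
    using m by (simp_all add: lam_product_def Vector_Spaces.linear_iff)
  have dleft: "cpoly_eval sC [:l:] (m (dpart sA a) b) = sC [:- l:] (cpoly_eval sC [:l:] (m a b))" for a b
  proof -
    have "ev sC (lam 0) (m (dpart sA a) b) = lsmult sC (- lam 0) (ev sC (lam 0) (m a b))"
      using m by (simp add: lam_product_def)
    from arg_cong[OF this, of "C.eval (\<lambda>_. l)"] show ?thesis by simp
  qed
  have dright: "cpoly_eval sC [:l:] (m a (dpart sB b)) = sC [:l, 1:] (cpoly_eval sC [:l:] (m a b))" for a b
  proof -
    have "ev sC (lam 0) (m a (dpart sB b)) = lsmult sC (dsym + lam 0) (ev sC (lam 0) (m a b))"
      using m by (simp add: lam_product_def)
    from arg_cong[OF this, of "C.eval (\<lambda>_. l)"] show ?thesis by simp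
  qed
  show "cpoly_eval sC [:l:] (m (sA q a + a') b)
        = sC [:poly q (- l):] (cpoly_eval sC [:l:] (m a b)) + cpoly_eval sC [:l:] (m a' b)"
    using polynomial_linear_extend[of sA sC "\<lambda>a. cpoly_eval sC [:l:] (m a b)" "[:- l:]" q a] assms
    by (simp add: left dleft pcompose_pCons_0)
  show "cpoly_eval sC [:l:] (m a (sB q b + b'))
        = sC (pcompose q [:l, 1:]) (cpoly_eval sC [:l:] (m a b)) + cpoly_eval sC [:l:] (m a b')"
    using polynomial_linear_extend[of sB sC "\<lambda>b. cpoly_eval sC [:l:] (m a b)" "[:l, 1:]" q b] assms
    by (simp add: right dright)
qed

context lsca_module
begin

sublocale A: poly_module sA
  by unfold_locales

sublocale M: poly_module sM
  by unfold_locales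

section \<open>Products and actions at numerical parameters\<close>

definition prod_at :: "complex \<Rightarrow> 'a \<Rightarrow> 'a \<Rightarrow> 'a" where
  "prod_at l a b = cpoly_eval sA [:l:] (mul a b)"

definition lact_at :: "complex \<Rightarrow> 'a \<Rightarrow> 'm \<Rightarrow> 'm" where
  "lact_at l a v = cpoly_eval sM [:l:] (lact a v)"

definition ract_at :: "complex \<Rightarrow> 'm \<Rightarrow> 'a \<Rightarrow> 'm" where
  "ract_at l v a = cpoly_eval sM [:l:] (ract v a)"

lemmas prod_at_left = lam_product_eval_left[OF module_axioms module_axioms module_axioms mul,
    folded prod_at_def]
lemmas prod_at_right = lam_product_eval_right[OF module_axioms module_axioms module_axioms mul,
    folded prod_at_def]
lemmas lact_at_left = lam_product_eval_left[OF module_axioms M.module_axioms M.module_axioms lact,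
    folded lact_at_def]
lemmas lact_at_right = lam_product_eval_right[OF module_axioms M.module_axioms M.module_axioms lact,
    folded lact_at_def]
lemmas ract_at_left = lam_product_eval_left[OF M.module_axioms module_axioms M.module_axioms ract,
    folded ract_at_def]
lemmas ract_at_right = lam_product_eval_right[OF M.module_axioms module_axioms M.module_axioms ract,
    folded ract_at_def]

lemma prod_at_diff_left: "prod_at l (a - a') b = prod_at l a b - prod_at l a' b"
  by (rule additive_diff[OF prod_at_left module_axioms]) (simp_all add: pcompose_1 flip: one_pCons)

lemma prod_at_diff_right: "prod_at l a (b - b') = prod_at l a b - prod_at l a b'"
  by (rule additive_diff[OF prod_at_right module_axioms]) (simp_all add: pcompose_1 flip: one_pCons)

lemma lact_at_diff_left: "lact_at l (a - a') v = lact_at l a v - lact_at l a' v"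
  by (rule additive_diff[OF lact_at_left module_axioms]) (simp_all add: pcompose_1 flip: one_pCons)

lemma lact_at_linear_right: "lact_at l a (sM [:c:] v + w) = sM [:c:] (lact_at l a v) + lact_at l a w"
  by (simp add: lact_at_right)

lemma lact_at_diff_right: "lact_at l a (v - w) = lact_at l a v - lact_at l a w"
  by (rule additive_diff[OF lact_at_right M.module_axioms]) (simp_all add: pcompose_1 flip: one_pCons)

lemma lact_at_add_right: "lact_at l a (v + w) = lact_at l a v + lact_at l a w"
  using lact_at_right[of l a 1 v w] by (simp add: pcompose_1)

lemma ract_at_linear_left: "ract_at l (sM [:c:] v + w) a = sM [:c:] (ract_at l v a) + ract_at l w a"
  by (simp add: ract_at_left)

lemma ract_at_diff_left: "ract_at l (v - w) a = ract_at l v a - ract_at l w a"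
  by (rule additive_diff[OF ract_at_left M.module_axioms]) (simp_all add: pcompose_1 flip: one_pCons)

lemma ract_at_add_left: "ract_at l (v + w) a = ract_at l v a + ract_at l w a"
  using ract_at_left[of l 1 v w a] by (simp flip: one_pCons)

lemma left_symmetry_at:
  "prod_at (l + k) (prod_at l a b) c - prod_at l a (prod_at k b c)
    = prod_at (l + k) (prod_at k b a) c - prod_at k b (prod_at l a c)"
proof -
  let ?\<phi> = "\<lambda>i::nat. if i = 0 then l else k"
  have "A.eval ?\<phi> (ext sA (\<lambda>x. ev sA (lam 0 + lam 1) (mul x c)) (ev sA (lam 0) (mul a b))
         - ext sA (\<lambda>x. ev sA (lam 0) (mul a x)) (ev sA (lam 1) (mul b c)))
     = A.eval ?\<phi> (ext sA (\<lambda>x. ev sA (lam 0 + lam 1) (mul x c)) (ev sA (lam 1) (mul b a))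
         - ext sA (\<lambda>x. ev sA (lam 1) (mul b x)) (ev sA (lam 0) (mul a c)))"
    by (simp only: left_symmetry)
  then show ?thesis
    by (simp add: A.eval_ext[OF module_axioms] prod_at_left prod_at_right flip: prod_at_def)
qed

lemma left_module_at:
  "lact_at (l + k) (prod_at l a b) v - lact_at l a (lact_at k b v)
    = lact_at (l + k) (prod_at k b a) v - lact_at k b (lact_at l a v)"
proof -
  let ?\<phi> = "\<lambda>i::nat. if i = 0 then l else k"
  have "M.eval ?\<phi> (ext sM (\<lambda>x. ev sM (lam 0 + lam 1) (lact x v)) (ev sA (lam 0) (mul a b))
         - ext sM (\<lambda>w. ev sM (lam 0) (lact a w)) (ev sM (lam 1) (lact b v)))
       = M.eval ?\<phi> (ext sM (\<lambda>x. ev sM (lam 0 + lam 1) (lact x v)) (ev sA (lam 1) (mul b a))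
         - ext sM (\<lambda>w. ev sM (lam 1) (lact b w)) (ev sM (lam 0) (lact a v)))"
    by (simp only: left_module)
  then show ?thesis
    by (simp add: M.eval_ext[OF module_axioms] M.eval_ext[OF M.module_axioms]
        lact_at_left lact_at_right flip: prod_at_def lact_at_def)
qed

lemma right_module_at:
  "ract_at (l + k) (lact_at l a v) b - lact_at l a (ract_at k v b)
    = ract_at (l + k) (ract_at k v a) b - ract_at k v (prod_at l a b)"
proof -
  let ?\<phi> = "\<lambda>i::nat. if i = 0 then l else k"
  have "M.eval ?\<phi> (ext sM (\<lambda>w. ev sM (lam 0 + lam 1) (ract w b)) (ev sM (lam 0) (lact a v))
         - ext sM (\<lambda>w. ev sM (lam 0) (lact a w)) (ev sM (lam 1) (ract v b)))
       = M.eval ?\<phi> (ext sM (\<lambda>w. ev sM (lam 0 + lam 1) (ract w b)) (ev sM (lam 1) (ract v a))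
         - ext sM (\<lambda>x. ev sM (lam 1) (ract v x)) (ev sA (lam 0) (mul a b)))"
    by (simp only: right_module)
  then show ?thesis
    by (simp add: M.eval_ext[OF module_axioms] M.eval_ext[OF M.module_axioms]
        lact_at_right ract_at_left ract_at_right flip: prod_at_def lact_at_def ract_at_def)
qed

text \<open>The coefficients of the Lie algebra complex are the graded conformal homomorphisms
  \<open>F = (F\<^sub>m)\<close> from \<open>A\<close> to \<open>M\<close>, with \<open>F\<^sub>m(\<partial>b) = (\<partial> + m) F\<^sub>m(b)\<close>.\<close>

definition hom_scale :: "complex \<Rightarrow> (complex \<Rightarrow> 'a \<Rightarrow> 'm) \<Rightarrow> complex \<Rightarrow> 'a \<Rightarrow> 'm" where
  "hom_scale c F = (\<lambda>m b. sM [:c:] (F m b))"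

text \<open>The conformal bracket with the parameter -\<partial>-l of its second half replaced by
  \<open>k\<close>; the two agree inside a slot of degree \<open>l + k\<close>.\<close>

definition commutator :: "complex \<Rightarrow> complex \<Rightarrow> 'a \<Rightarrow> 'a \<Rightarrow> 'a" where
  "commutator l k a b = prod_at l a b - prod_at k b a"

text \<open>The right action is taken at \<open>m\<close> because that is the degree of
  \<open>F (m - l) a\<close> when \<open>a\<close> sits in degree \<open>l\<close>.\<close>

definition hom_act :: "complex \<Rightarrow> 'a \<Rightarrow> (complex \<Rightarrow> 'a \<Rightarrow> 'm) \<Rightarrow> complex \<Rightarrow> 'a \<Rightarrow> 'm" where
  "hom_act l a F = (\<lambda>m b. lact_at l a (F (m - l) b) + ract_at m (F (m - l) a) b
     - F (m - l) (prod_at l a b))"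

definition homs :: "(complex \<Rightarrow> 'a \<Rightarrow> 'm) set" where
  "homs = {F. \<forall>m q b b'. F m (sA q b + b') = sM (pcompose q [:m, 1:]) (F m b) + F m b'}"

text \<open>Families over all degrees are used so that one vector space with one action serves every
  degree.\<close>

definition homs_of_degree :: "complex \<Rightarrow> (complex \<Rightarrow> 'a \<Rightarrow> 'm) set" where
  "homs_of_degree m = {F. \<forall>k b. k \<noteq> m \<longrightarrow> F k b = 0}"

lemma homsD: "F \<in> homs \<Longrightarrow> F m (sA q b + b') = sM (pcompose q [:m, 1:]) (F m b) + F m b'"
  by (simp add: homs_def)

lemma homs_diff:
  assumes "F \<in> homs"
  shows "F m (b - b') = F m b - F m b'"
  by (rule additive_diff[where t = "\<lambda>q. sM (pcompose q [:m, 1:])" and f = "F m",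
        OF homsD[OF assms] module_axioms])
    (simp add: pcompose_1)

lemma pcompose_shift_shift:
  "pcompose (pcompose q [:l, 1:]) [:k, 1 :: complex:] = pcompose q [:l + k, 1:]"
  by (simp add: pcompose_pCons flip: pcompose_assoc)

lemma commutator_jacobi:
  "commutator l (m + k) a (commutator m k b c)
    = commutator (l + m) k (commutator l m a b) c + commutator m (l + k) b (commutator l k a c)"
proof -
  \<comment> \<open>The Jacobi defect is a signed sum of three differences of associators, for (a,
    b, c), (b, c, a) and (a, c, b); left symmetry kills each.\<close>
  have "commutator l (m + k) a (commutator m k b c)
      - (commutator (l + m) k (commutator l m a b) c + commutator m (l + k) b (commutator l k a c))
    = - ((prod_at (l + m) (prod_at l a b) c - prod_at l a (prod_at m b c))
        - (prod_at (l + m) (prod_at m b a) c - prod_at m b (prod_at l a c)))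
      - ((prod_at (m + k) (prod_at m b c) a - prod_at m b (prod_at k c a))
        - (prod_at (m + k) (prod_at k c b) a - prod_at k c (prod_at m b a)))
      + ((prod_at (l + k) (prod_at l a c) b - prod_at l a (prod_at k c b))
        - (prod_at (l + k) (prod_at k c a) b - prod_at k c (prod_at l a b)))"
    by (simp add: commutator_def prod_at_diff_left prod_at_diff_right algebra_simps)
  then show ?thesis
    unfolding left_symmetry_at[of l m a b c] left_symmetry_at[of m k b c a]
      left_symmetry_at[of l k a c b] by simp
qed

text \<open>Both halves give q(-m): \<open>prod_at m b a\<close> directly, and
  \<open>prod_at l a b\<close> as q(\<partial>+l), where \<open>f\<close> makes \<partial> equal to
  -(l + m).\<close>

lemma commutator_slot_right:
  assumes "module sV"
    and f: "\<And>q x y. f (sA q x + y) = sV (poly q (- (l + m))) (f x) + (f y :: 'v::ab_group_add)"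
  shows "f (commutator l m a (sA q b + b'))
    = sV (poly q (- m)) (f (commutator l m a b)) + f (commutator l m a b')"
proof -
  interpret V: module sV by fact
  have 1: "f (x + y) = f x + f y" for x y using f[of 1 x y] by simp
  have d: "f (x - y) = f x - f y" for x y
    by (rule additive_diff[OF f module_axioms]) (simp_all add: pcompose_1 flip: one_pCons)
  have s: "f (sA q x) = sV (poly q (- (l + m))) (f x)" for q x
    using f[of q x 0] d[of 0 0] by simp
  show ?thesis
    by (simp add: commutator_def prod_at_left prod_at_right 1 d s poly_pcompose
        V.scale_right_diff_distrib)
qed

text \<open>The right action yields the same scalar as the other two summands: q leaves
  \<open>F\<close> as q(\<partial>+m-l), and then \<partial> becomes -m.\<close>

lemma hom_act_slot:
  assumes "F \<in> homs"
  shows "hom_act l (sA q a + b) F = hom_scale (poly q (- l)) (hom_act l a F) + hom_act l b F"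
  by (rule ext, rule ext)
    (simp add: hom_act_def hom_scale_def homsD[OF assms] lact_at_left prod_at_left ract_at_left
      poly_pcompose M.scale_right_distrib M.scale_right_diff_distrib)

lemma hom_act_in_homs:
  assumes "F \<in> homs"
  shows "hom_act l a F \<in> homs"
  unfolding homs_def
proof (intro CollectI allI)
  fix m q b b'
  have "l + (m - l) = m" "m - l + l = m" by simp_all
  then show "hom_act l a F m (sA q b + b')
      = sM (pcompose q [:m, 1:]) (hom_act l a F m b) + hom_act l a F m b'"
    by (simp add: hom_act_def homsD[OF assms] lact_at_right prod_at_right ract_at_right
        pcompose_shift_shift M.scale_right_distrib M.scale_right_diff_distrib)
qed

lemma hom_act_commutator:
  assumes "F \<in> homs"
  shows "hom_act (l + k) (commutator l k a c) F
    = hom_act l a (hom_act k c F) - hom_act k c (hom_act l a F)"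
proof (rule ext, rule ext)
  fix m b
  \<comment> \<open>Both orders of acting read \<open>F\<close> in this one degree.\<close>
  define E where "E = F (m - (l + k))"
  have E: "F (m - l - k) = E" "F (m - k - l) = E"
    by (simp_all add: E_def diff_diff_eq add.commute)
  have E_diff: "E (x - y) = E x - E y" for x y
    using assms by (simp add: E_def homs_diff)
  \<comment> \<open>The defect splits into the left module identity on \<open>E b\<close>, the right
    module identity on \<open>E c\<close> and on \<open>E a\<close>, of degrees m - l and m - k, and
    left symmetry inside \<open>E\<close>.\<close>
  have "hom_act (l + k) (commutator l k a c) F m b
      - (hom_act l a (hom_act k c F) - hom_act k c (hom_act l a F)) m b
    = ((lact_at (l + k) (prod_at l a c) (E b) - lact_at l a (lact_at k c (E b)))
        - (lact_at (l + k) (prod_at k c a) (E b) - lact_at k c (lact_at l a (E b))))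
      + ((ract_at m (lact_at l a (E c)) b - lact_at l a (ract_at (m - l) (E c) b))
        - (ract_at m (ract_at (m - l) (E c) a) b - ract_at (m - l) (E c) (prod_at l a b)))
      - ((ract_at m (lact_at k c (E a)) b - lact_at k c (ract_at (m - k) (E a) b))
        - (ract_at m (ract_at (m - k) (E a) c) b - ract_at (m - k) (E a) (prod_at k c b)))
      - (E (prod_at (l + k) (prod_at l a c) b - prod_at l a (prod_at k c b))
        - E (prod_at (l + k) (prod_at k c a) b - prod_at k c (prod_at l a b)))"
    by (simp add: hom_act_def E commutator_def lact_at_diff_left lact_at_diff_right
        lact_at_add_right ract_at_diff_left ract_at_add_left prod_at_diff_left E_diff
        flip: E_def)
  moreover note left_module_at[of l k a c "E b"] right_module_at[of l "m - l" a "E c" b]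
    right_module_at[of k "m - k" c "E a" b] left_symmetry_at[of l k a c b]
  ultimately show "hom_act (l + k) (commutator l k a c) F m b
      = (hom_act l a (hom_act k c F) - hom_act k c (hom_act l a F)) m b"
    by simp
qed

lemma vector_space_hom_scale: "vector_space hom_scale"
proof -
  interpret M': vector_space "\<lambda>c. sM [:c:]" by (rule M.vector_space_const)
  show ?thesis
    by unfold_locales
      (simp_all add: hom_scale_def fun_eq_iff M.scale_right_distrib M'.scale_left_distrib
        mult.commute flip: one_pCons)
qed

sublocale L: graded_lie_representation sA hom_scale commutator hom_act homs homs_of_degree
proof -
  interpret V: vector_space hom_scale by (rule vector_space_hom_scale)
  show "graded_lie_representation sA hom_scale commutator hom_act homs homs_of_degree"
  proof unfold_locales
    fix l m k :: complex and a b c :: 'a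
    show "commutator m l b a = - commutator l m a b"
      by (simp add: commutator_def)
    show "commutator l (m + k) a (commutator m k b c)
      = commutator (l + m) k (commutator l m a b) c + commutator m (l + k) b (commutator l k a c)"
      by (rule commutator_jacobi)
  next
    fix f :: "'a \<Rightarrow> complex \<Rightarrow> 'a \<Rightarrow> 'm" and l m q a b b'
    assume "\<And>q x y. f (sA q x + y) = hom_scale (poly q (- (l + m))) (f x) + f y"
    then show "f (commutator l m a (sA q b + b'))
      = hom_scale (poly q (- m)) (f (commutator l m a b)) + f (commutator l m a b')"
      by (rule commutator_slot_right[OF V.module_axioms])
  next
    fix l a r and F F' :: "complex \<Rightarrow> 'a \<Rightarrow> 'm"
    show "hom_act l a (hom_scale r F + F') = hom_scale r (hom_act l a F) + hom_act l a F'"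
      by (rule ext, rule ext)
        (simp add: hom_act_def hom_scale_def lact_at_linear_right ract_at_linear_left
          M.scale_right_distrib M.scale_right_diff_distrib)
  next
    fix F l q a b assume "F \<in> homs"
    then show "hom_act l (sA q a + b) F = hom_scale (poly q (- l)) (hom_act l a F) + hom_act l b F"
      by (rule hom_act_slot)
  next
    fix F l m a b assume "F \<in> homs"
    then show "hom_act (l + m) (commutator l m a b) F
      = hom_act l a (hom_act m b F) - hom_act m b (hom_act l a F)"
      by (rule hom_act_commutator)
  next
    show "0 \<in> homs" by (simp add: homs_def)
  next
    fix F F' r assume "F \<in> homs" "F' \<in> homs"
    then show "hom_scale r F + F' \<in> homs"
      by (simp add: homs_def hom_scale_def M.scale_right_distrib mult.commute)
  next
    fix F l a assume "F \<in> homs"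
    then show "hom_act l a F \<in> homs" by (rule hom_act_in_homs)
  next
    fix m show "0 \<in> homs_of_degree m" by (simp add: homs_of_degree_def)
  next
    fix m r F F' assume "F \<in> homs_of_degree m" "F' \<in> homs_of_degree m"
    then show "hom_scale r F + F' \<in> homs_of_degree m"
      by (simp add: homs_of_degree_def hom_scale_def)
  next
    fix l m a F assume F: "F \<in> homs_of_degree m"
    have "lact_at l a 0 = 0" "ract_at k 0 b = 0" for k b
      using lact_at_diff_right[of l a 0 0] ract_at_diff_left[of k 0 0 b] by simp_all
    with F show "hom_act l a F \<in> homs_of_degree (l + m)"
      by (simp add: homs_of_degree_def hom_act_def diff_eq_eq add.commute)
  qed
qed

end


section \<open>Cochains and the coboundary in terms of values\<close>

lemma map_omit: "map f (omit i xs) = omit i (map f xs)"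
  by (simp add: omit_def take_map drop_map)

lemma length_omit: "i < length xs \<Longrightarrow> length (omit i xs) = length xs - 1"
  by (auto simp: omit_def min_def)

lemma length_omit2: "i < j \<Longrightarrow> j < length xs \<Longrightarrow> length (omit2 i j xs) = length xs - 2"
  by (simp add: omit2_def length_omit)

lemma omit_snoc: "i < length xs \<Longrightarrow> omit i (xs @ [x]) = omit i xs @ [x]"
  by (simp add: omit_def)

lemma nth_omit: "i < j \<Longrightarrow> j < length xs \<Longrightarrow> omit j xs ! i = xs ! i"
  by (simp add: omit_def nth_append)

lemma sum_list_omit:
  fixes f :: "'b \<Rightarrow> 'c::ab_group_add"
  assumes "i < length xs"
  shows "sum_list (map f (omit i xs)) = sum_list (map f xs) - f (xs ! i)"
  by (subst (2) id_take_nth_drop[OF assms]) (simp add: omit_def)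

lemma sum_fun_apply: "(\<Sum>i\<in>I. f i) x = (\<Sum>i\<in>I. f i x :: 'c::comm_monoid_add)"
  by (induction I rule: infinite_finite_induct) simp_all

text \<open>The default 0 is harmless: a cochain value involves only variables that have an entry in
  the list.\<close>

definition params :: "complex list \<Rightarrow> nat \<Rightarrow> complex" where
  "params ls j = (if j < length ls then ls ! j else 0)"

context lsca_module
begin

text \<open>The parameters and the first arguments of a cochain form a list of graded elements of \<open>A\<close>;
  the last argument carries no parameter and is that of the value in \<open>homs\<close>.\<close>
definition graded_values :: "('a list \<Rightarrow> 'm lpoly) \<Rightarrow> (complex \<times> 'a) list \<Rightarrow> complex \<Rightarrow> 'a \<Rightarrow> 'm" where
  "graded_values \<gamma> ps m b = (if m = sum_list (map fst ps)
     then M.eval (params (map fst ps)) (\<gamma> (map snd ps @ [b])) else 0)"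

lemma graded_values_eq:
  "m = sum_list (map fst ps) \<Longrightarrow>
    graded_values \<gamma> ps m b = M.eval (params (map fst ps)) (\<gamma> (map snd ps @ [b]))"
  by (simp add: graded_values_def)

lemma graded_values_eqI:
  assumes "in_vars k (\<gamma> (map snd ps @ [b]))" "length ps = k" "m = sum_list (map fst ps)"
    and "\<And>j. j < k \<Longrightarrow> \<phi> j = fst (ps ! j)"
  shows "M.eval \<phi> (\<gamma> (map snd ps @ [b])) = graded_values \<gamma> ps m b"
  unfolding graded_values_eq[OF assms(3)]
  by (rule M.eval_in_vars_cong[OF assms(1)]) (simp add: params_def assms)

lemma vector_space_lsmult: "vector_space (\<lambda>c. lsmult sM (lconst [:c:]))"
proof unfold_locales
  fix a b :: complex and x y :: "'m lpoly"
  show "lsmult sM (lconst [:a:]) (x + y) = lsmult sM (lconst [:a:]) x + lsmult sM (lconst [:a:]) y"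
    by (rule M.lpoly_eqI) (simp add: M.scale_right_distrib)
  show "lsmult sM (lconst [:a + b:]) x = lsmult sM (lconst [:a:]) x + lsmult sM (lconst [:b:]) x"
    using M.scale_left_distrib[of "[:a:]" "[:b:]"] by (intro M.lpoly_eqI) simp
  show "lsmult sM (lconst [:a:]) (lsmult sM (lconst [:b:]) x) = lsmult sM (lconst [:a * b:]) x"
    by (rule M.lpoly_eqI) (simp add: mult.commute)
  show "lsmult sM (lconst [:1:]) x = x"
    by (rule M.lpoly_eqI) (simp flip: one_pCons)
qed

section \<open>Cochains as alternating sesquilinear maps of graded elements\<close>

context
  fixes n :: nat and \<gamma> :: "'a list \<Rightarrow> 'm lpoly"
  assumes n: "n \<ge> 1" and cochain: "\<gamma> \<in> cochains sA sM n"
begin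

lemma cochain_length: "length as \<noteq> n \<Longrightarrow> \<gamma> as = 0"
  using cochain by (simp add: cochains_def)

lemma cochain_in_vars: "length as = n \<Longrightarrow> in_vars (n - 1) (\<gamma> as)"
  using cochain by (simp add: cochains_def)

text \<open>\<open>r\<close> is the image of \<partial>: the slots with a parameter turn it into a
  number, the last one adds all parameters to it.\<close>

lemma cochain_eval_slot:
  assumes as: "length as = n" and i: "i < n"
    and r: "r = (if i < n - 1 then [:- \<phi> i:] else [:\<Sum>j<n - 1. \<phi> j, 1:])"
  shows "M.eval \<phi> (\<gamma> (as[i := sA q x + y]))
    = sM (pcompose q r) (M.eval \<phi> (\<gamma> (as[i := x]))) + M.eval \<phi> (\<gamma> (as[i := y]))"
proof -
  have lin: "Vector_Spaces.linear (\<lambda>c. sA [:c:]) (\<lambda>c. lsmult sM (lconst [:c:])) (\<lambda>x. \<gamma> (as[i := x]))"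
    using cochain as i by (simp add: cochains_def)
  have add: "\<gamma> (as[i := x + y]) = \<gamma> (as[i := x]) + \<gamma> (as[i := y])"
    and const: "\<gamma> (as[i := sA [:c:] x]) = lsmult sM (lconst [:c:]) (\<gamma> (as[i := x]))" for x y c
    using lin by (simp_all add: Vector_Spaces.linear_iff)
  have "M.eval \<phi> (\<gamma> (as[i := dpart sA x])) = sM r (M.eval \<phi> (\<gamma> (as[i := x])))" for x
  proof (cases "i < n - 1")
    case True
    have "\<forall>as. length as = n \<longrightarrow> (\<forall>i<n - 1. \<gamma> (as[i := dpart sA (as ! i)]) = lsmult sM (- lam i) (\<gamma> as))"
      using cochain by (simp add: cochains_def)
    from this[rule_format, of "as[i := x]" i] show ?thesis
      using True as i r by simp
  next
    case False
    then have i': "i = n - 1" using i by simp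
    have "\<forall>as. length as = n \<longrightarrow> \<gamma> (as[n - 1 := dpart sA (as ! (n - 1))])
          = lsmult sM (dsym + (\<Sum>j<n - 1. lam j)) (\<gamma> as)"
      using cochain by (simp add: cochains_def)
    from this[rule_format, of "as[i := x]"] show ?thesis
      using as i r i' by (simp add: const_sum)
  qed
  then show ?thesis
    using polynomial_linear_extend[of sA sM "\<lambda>x. M.eval \<phi> (\<gamma> (as[i := x]))" r q x]
      module_axioms M.module_axioms
    by (simp add: add const)
qed

lemma cochain_slot_linear: "L.slot_linear (graded_values \<gamma>)"
  unfolding L.slot_linear_def
proof (intro allI ext)
  fix u v :: "(complex \<times> 'a) list" and l q a b m c
  let ?\<phi> = "params (map fst u @ l # map fst v)"
  let ?as = "\<lambda>x. map snd u @ x # map snd v @ [c]"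
  let ?i = "length u"
  have "M.eval ?\<phi> (\<gamma> (?as (sA q a + b)))
      = sM [:poly q (- l):] (M.eval ?\<phi> (\<gamma> (?as a))) + M.eval ?\<phi> (\<gamma> (?as b))"
  \<comment> \<open>The slot itself and the last argument \<open>c\<close> account for the 2; for
    other lengths all terms are 0.\<close>
  proof (cases "length u + length v + 2 = n")
    case True
    have "(?as 0)[?i := x] = ?as x" for x
      by (simp add: list_update_append)
    moreover have "?\<phi> ?i = l" by (simp add: params_def nth_append)
    moreover have "?i < n - 1" using True by simp
    ultimately show ?thesis
      using cochain_eval_slot[of "?as 0" ?i "[:- l:]" ?\<phi> q a b] True
      by (simp add: pcompose_pCons_0)
  next
    case False
    then show ?thesis by (simp add: cochain_length)
  qed
  then show "graded_values \<gamma> (u @ (l, sA q a + b) # v) m c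
      = (hom_scale (poly q (- l)) (graded_values \<gamma> (u @ (l, a) # v)) + graded_values \<gamma> (u @ (l, b) # v)) m c"
    by (simp add: graded_values_def hom_scale_def)
qed

lemma cochain_in_homs: "graded_values \<gamma> ps \<in> homs"
  unfolding homs_def
proof (intro CollectI allI)
  fix m q b b'
  show "graded_values \<gamma> ps m (sA q b + b')
      = sM (pcompose q [:m, 1:]) (graded_values \<gamma> ps m b) + graded_values \<gamma> ps m b'"
  proof (cases "Suc (length ps) = n")
    case True
    have "(map snd ps @ [0])[length ps := x] = map snd ps @ [x]" for x
      using list_update_length[of "map snd ps" 0 "[]" x] by simp
    moreover have "(\<Sum>j<length ps. params (map fst ps) j) = sum_list (map fst ps)"
      by (simp add: sum_list_sum_nth params_def atLeast0LessThan)
    ultimately show ?thesis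
      using cochain_eval_slot[of "map snd ps @ [0]" "length ps" _ "params (map fst ps)" q b b'] True
      by (auto simp: graded_values_def)
  next
    case False
    then show ?thesis by (simp add: graded_values_def cochain_length)
  qed
qed

text \<open>A graded element pairs a parameter with its argument, so exchanging list entries
  performs both interchanges of the cochain condition at once.\<close>

lemma cochain_alternating: "L.alternating (graded_values \<gamma>)"
  unfolding L.alternating_def
proof (intro allI ext)
  fix u v :: "(complex \<times> 'a) list" and x y :: "complex \<times> 'a" and m c
  let ?as = "\<lambda>x y. map snd u @ snd x # snd y # map snd v @ [c]"
  let ?\<phi> = "\<lambda>x y. params (map fst u @ fst x # fst y # map fst v)"
  let ?i = "length u"
  have "M.eval (?\<phi> x y) (\<gamma> (?as x y)) = - M.eval (?\<phi> y x) (\<gamma> (?as y x))"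
  proof (cases "length u + length v + 3 = n")
    case True
    have "\<forall>as. length as = n \<longrightarrow> (\<forall>i j. i < j \<and> j < n - 1 \<longrightarrow>
           subst sM (\<lambda>k. lam (transpose i j k)) (\<gamma> (as[i := as ! j, j := as ! i])) = - \<gamma> as)"
      using cochain by (simp add: cochains_def)
    from this[rule_format, of "?as x y" ?i "Suc ?i"]
    have "subst sM (\<lambda>k. lam (transpose ?i (Suc ?i) k)) (\<gamma> (?as y x)) = - \<gamma> (?as x y)"
      using True by (simp add: list_update_append nth_append)
    moreover have "M.eval (?\<phi> x y) (subst sM (\<lambda>k. lam (transpose ?i (Suc ?i) k)) (\<gamma> (?as y x)))
        = M.eval (?\<phi> y x) (\<gamma> (?as y x))"
    proof (rule M.eval_subst)
      show "in_vars (n - 1) (\<gamma> (?as y x))"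
        using True by (intro cochain_in_vars) simp
      fix j
      have "?\<phi> x y (transpose ?i (Suc ?i) j) = ?\<phi> y x j"
        by (auto simp: transpose_def params_def nth_append nth_Cons split: nat.splits)
      then show "reval (?\<phi> x y) (lam (transpose ?i (Suc ?i) j)) = [:?\<phi> y x j:]"
        by simp
    qed
    ultimately show ?thesis by (metis M.eval_uminus minus_minus)
  next
    case False
    then show ?thesis by (simp add: cochain_length)
  qed
  then show "graded_values \<gamma> (u @ x # y # v) m c = (- graded_values \<gamma> (u @ y # x # v)) m c"
    by (simp add: graded_values_def add.left_commute)
qed

lemma cochain_graded: "graded_values \<gamma> ps \<in> homs_of_degree (0 + sum_list (map fst ps))"
  by (simp add: homs_of_degree_def graded_values_def)

lemma cochain_values_length: "Suc (length ps) \<noteq> n \<Longrightarrow> graded_values \<gamma> ps = 0"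
  by (simp add: graded_values_def fun_eq_iff cochain_length)

lemma eval_at_params:
  assumes "length as = n - 1" "length Ls = n - 1" "length ps = n - 1"
    and "\<And>j. j < n - 1 \<Longrightarrow> reval \<phi> (Ls ! j) = [:fst (ps ! j):]"
    and "as = map snd ps" "m = sum_list (map fst ps)"
  shows "M.eval \<phi> (at_params sM \<gamma> Ls (as @ [b])) = graded_values \<gamma> ps m b"
  unfolding at_params_def graded_values_eq[OF assms(6)] assms(5)
  using n assms cochain_in_vars[of "map snd ps @ [b]"]
  by (intro M.eval_subst[of "n - 1"]) (simp_all add: params_def)

text \<open>The first three sums of the coboundary are the three summands of \<open>hom_act\<close>;
  the fourth is the bracket sum of \<open>differential_eq\<close>.\<close>

theorem eval_coboundary:
  assumes bs: "length bs = n"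
  shows "M.eval \<phi> (coboundary sA mul sM lact ract n \<gamma> (bs @ [b]))
    = L.differential (graded_values \<gamma>) (zip (map \<phi> [0..<n]) bs) (\<Sum>j<n. \<phi> j) b"
proof -
  define ps where "ps = zip (map \<phi> [0..<n]) bs"
  define s where "s = (\<Sum>j<n. \<phi> j)"
  let ?G = "graded_values \<gamma>"
  let ?Ls = "map lam [0..<n]"
  have ps: "length ps = n" "map fst ps = map \<phi> [0..<n]" "map snd ps = bs"
    "\<And>i. i < n \<Longrightarrow> ps ! i = (\<phi> i, bs ! i)"
    using bs by (simp_all add: ps_def)
  have s: "s = sum_list (map fst ps)"
    by (simp add: s_def ps sum_list_sum_nth atLeast0LessThan)
  have reval_Ls: "map (reval \<phi>) ?Ls = map (\<lambda>p. [:fst p:]) ps"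
    by (rule nth_equalityI) (use ps(1,4) in simp_all)
  have reval_omit: "reval \<phi> (omit i ?Ls ! j) = [:fst (omit i ps ! j):]" if "i < n" "j < n - 1" for i j
  proof -
    have "map (reval \<phi>) (omit i ?Ls) = map (\<lambda>p. [:fst p:]) (omit i ps)"
      unfolding map_omit reval_Ls ..
    from arg_cong[OF this, of "\<lambda>xs. xs ! j"] show ?thesis
      using that ps by (simp add: length_omit)
  qed
  have at_omit: "M.eval \<phi> (at_params sM \<gamma> (omit i ?Ls) (omit i bs @ [x])) = ?G (omit i ps) (s - \<phi> i) x"
    if i: "i < n" for i x
  proof (rule eval_at_params)
    show "omit i bs = map snd (omit i ps)"
      by (simp only: map_omit ps)
    show "s - \<phi> i = sum_list (map fst (omit i ps))"
      using i by (simp add: sum_list_omit ps(1,4) s)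
  qed (use i bs ps(1) reval_omit in \<open>simp_all add: length_omit\<close>)
  have term1: "M.eval \<phi> (ext sM (\<lambda>v. ev sM (lam i) (lact ((bs @ [b]) ! i) v))
              (at_params sM \<gamma> (omit i ?Ls) (omit i (bs @ [b]))))
      = lact_at (\<phi> i) (bs ! i) (?G (omit i ps) (s - \<phi> i) b)" if i: "i < n" for i
    using i bs at_omit[OF i]
    by (simp add: M.eval_ext[OF M.module_axioms] lact_at_right omit_snoc nth_append flip: lact_at_def)
  have term2: "M.eval \<phi> (ext sM (\<lambda>v. ev sM (\<Sum>j<n. lam j) (ract v ((bs @ [b]) ! n)))
              (at_params sM \<gamma> (omit i ?Ls) (omit i bs @ [(bs @ [b]) ! i])))
      = ract_at s (?G (omit i ps) (s - \<phi> i) (bs ! i)) b" if i: "i < n" for i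
    using i bs at_omit[OF i]
    by (simp add: M.eval_ext[OF M.module_axioms] ract_at_left nth_append const_sum
        flip: ract_at_def s_def)
  have term3: "M.eval \<phi> (ext sM (\<lambda>x. at_params sM \<gamma> (omit i ?Ls) (omit i bs @ [x]))
              (ev sA (lam i) (mul ((bs @ [b]) ! i) ((bs @ [b]) ! n))))
      = ?G (omit i ps) (s - \<phi> i) (prod_at (\<phi> i) (bs ! i) b)" if i: "i < n" for i
    using i bs at_omit[OF i]
    by (simp add: M.eval_ext[OF module_axioms] homsD[OF cochain_in_homs] nth_append
        flip: prod_at_def)
  have term4: "M.eval \<phi> (ext sM (\<lambda>x. at_params sM \<gamma> ((lam i + lam j) # omit2 i j ?Ls) (x # omit2 i j (bs @ [b])))
              (bracket sA mul (lam i) ((bs @ [b]) ! i) ((bs @ [b]) ! j)))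
      = ?G (L.ad (ps ! i) (ps ! j) # omit2 i j ps) s b" if i: "i < j" and j: "j < n" for i j
  proof -
    let ?H = "\<lambda>x. ?G ((\<phi> i + \<phi> j, x) # omit2 i j ps) s b"
    have map_reval: "map (reval \<phi>) (omit2 i j ?Ls) = map (\<lambda>p. [:fst p:]) (omit2 i j ps)"
      unfolding omit2_def map_omit reval_Ls ..
    have reval: "reval \<phi> (omit2 i j ?Ls ! k) = [:fst (omit2 i j ps ! k):]" if "k < n - 2" for k
      using arg_cong[OF map_reval, of "\<lambda>xs. xs ! k"] that i j ps(1)
      by (simp add: length_omit2)
    have sum: "s = \<phi> i + \<phi> j + sum_list (map fst (omit2 i j ps))"
      using i j by (simp add: s omit2_def sum_list_omit length_omit nth_omit ps(1,4))
    have snoc: "omit2 i j (bs @ [b]) = omit2 i j bs @ [b]"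
      using i j bs by (simp add: omit2_def omit_snoc length_omit)
    have at: "M.eval \<phi> (at_params sM \<gamma> ((lam i + lam j) # omit2 i j ?Ls) (x # omit2 i j (bs @ [b]))) = ?H x" for x
      unfolding snoc append_Cons[symmetric]
    proof (rule eval_at_params)
      fix k assume "k < n - 1"
      then show "reval \<phi> (((lam i + lam j) # omit2 i j ?Ls) ! k)
          = [:fst (((\<phi> i + \<phi> j, x) # omit2 i j ps) ! k):]"
        using reval by (cases k) auto
    next
      show "x # omit2 i j bs = map snd ((\<phi> i + \<phi> j, x) # omit2 i j ps)"
        by (simp only: omit2_def map_omit ps list.map snd_conv)
      show "s = sum_list (map fst ((\<phi> i + \<phi> j, x) # omit2 i j ps))"
        using sum by simp
    qed (use i j bs ps(1) in \<open>simp_all add: length_omit2\<close>)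
    have H: "?H (sA q x + y) = sM [:poly q (- (\<phi> i + \<phi> j)):] (?H x) + ?H y" for q x y
      using L.slot_linear_Cons_arg[OF cochain_slot_linear, of "\<phi> i + \<phi> j" q x y "omit2 i j ps"]
      by (simp add: hom_scale_def)
    \<comment> \<open>The polynomial -\<partial>-\<phi> i takes the value \<phi> j at \<partial> =
      -(\<phi> i + \<phi> j), which is how \<partial> acts in the first slot.\<close>
    have "?H (cpoly_eval sA [:- \<phi> i, - 1:] x) = ?H (cpoly_eval sA [:\<phi> j:] x)" for x
      by (rule A.cpoly_eval_slot[where f = ?H, OF M.vector_space_const H]) simp
    moreover have "?H (x - y) = ?H x - ?H y" for x y
      by (rule additive_diff[where s = sA and t = "\<lambda>q. sM [:poly q (- (\<phi> i + \<phi> j)):]" and f = ?H,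
            OF H module_axioms]) (simp flip: one_pCons)
    ultimately show ?thesis
      using i j bs
      by (simp add: M.eval_ext[OF module_axioms] at H bracket_def ps nth_append L.ad_def
          commutator_def prod_at_def)
  qed
  have sign: "reval \<phi> ((- 1) ^ i) = [:(- 1) ^ i:]" for i
    by (simp add: const_minus_one_power)
  have "M.eval \<phi> (coboundary sA mul sM lact ract n \<gamma> (bs @ [b]))
    = (\<Sum>i<n. sM [:(- 1) ^ i:] (lact_at (\<phi> i) (bs ! i) (?G (omit i ps) (s - \<phi> i) b)))
    + (\<Sum>i<n. sM [:(- 1) ^ i:] (ract_at s (?G (omit i ps) (s - \<phi> i) (bs ! i)) b))
    - (\<Sum>i<n. sM [:(- 1) ^ i:] (?G (omit i ps) (s - \<phi> i) (prod_at (\<phi> i) (bs ! i) b)))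
    + (\<Sum>j<n. \<Sum>i<j. sM [:(- 1) ^ (i + j):] (?G (L.ad (ps ! i) (ps ! j) # omit2 i j ps) s b))"
    using bs by (simp add: coboundary_def Let_def M.eval_lsmult sign term1 term2 term3 term4
        del: M.eval_ev reval_power)
  also have "\<dots> = L.differential ?G ps s b"
    using ps
    by (simp add: L.differential_eq[OF cochain_alternating] sum_fun_apply hom_scale_def hom_act_def
        M.scale_right_distrib M.scale_right_diff_distrib sum.distrib sum_subtractf)
  finally show ?thesis by (simp add: ps_def s_def)
qed

text \<open>By \<open>eval_coboundary\<close> the value depends only on the first \<open>n\<close>
  entries of the assignment.\<close>

lemma coboundary_in_vars: "length as = Suc n \<Longrightarrow> in_vars n (coboundary sA mul sM lact ract n \<gamma> as)"
proof (rule M.in_varsI)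
  fix \<phi> \<psi> :: "nat \<Rightarrow> complex"
  assume as: "length as = Suc n" and eq: "\<And>j. j < n \<Longrightarrow> \<phi> j = \<psi> j"
  obtain bs b where bs: "as = bs @ [b]" "length bs = n"
    using as by (metis length_Suc_conv_rev)
  have "map \<phi> [0..<n] = map \<psi> [0..<n]" "(\<Sum>j<n. \<phi> j) = (\<Sum>j<n. \<psi> j)"
    using eq by simp_all
  then show "M.eval \<phi> (coboundary sA mul sM lact ract n \<gamma> as)
      = M.eval \<psi> (coboundary sA mul sM lact ract n \<gamma> as)"
    using eval_coboundary[OF bs(2)] by (simp only: bs(1))
qed

text \<open>Equality on all lists and in all degrees allows insertion into a second
  differential.\<close>

lemma graded_values_coboundary:
  "graded_values (coboundary sA mul sM lact ract n \<gamma>) = L.differential (graded_values \<gamma>)"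
proof (rule ext)
  fix ps
  show "graded_values (coboundary sA mul sM lact ract n \<gamma>) ps = L.differential (graded_values \<gamma>) ps"
  proof (cases "length ps = n")
    case True
    have "zip (map (params (map fst ps)) [0..<n]) (map snd ps) = ps"
      using True by (intro nth_equalityI) (simp_all add: params_def)
    moreover have "(\<Sum>j<n. params (map fst ps) j) = sum_list (map fst ps)"
      using True by (simp add: sum_list_sum_nth params_def atLeast0LessThan)
    \<comment> \<open>Off the total degree the left side is 0 by definition, the right side by
      homogeneity.\<close>
    moreover have "L.differential (graded_values \<gamma>) ps \<in> homs_of_degree (0 + sum_list (map fst ps))"
      by (rule L.differential_graded) (rule cochain_graded)
    ultimately show ?thesis
      using eval_coboundary[of "map snd ps" "params (map fst ps)"] True
      by (auto simp: fun_eq_iff graded_values_def homs_of_degree_def)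
  next
    case False
    then have "graded_values (coboundary sA mul sM lact ract n \<gamma>) ps = 0"
      by (simp add: fun_eq_iff graded_values_def coboundary_def)
    \<comment> \<open>Every argument list in the closed formula is one shorter than
      \<open>ps\<close>, hence of the wrong length for \<open>\<gamma>\<close>.\<close>
    moreover have "L.differential (graded_values \<gamma>) ps = 0"
      unfolding L.differential_eq[OF cochain_alternating] using False
      by (simp add: cochain_values_length length_omit length_omit2 L.act_0)
    ultimately show ?thesis by simp
  qed
qed

end

text \<open>Converse of the translation above: it recovers the defining identities of a cochain from
  properties that the differential preserves.\<close>

lemma cochainsI:
  assumes n: "n \<ge> 1"
    and zero: "\<And>as. length as \<noteq> n \<Longrightarrow> \<gamma> as = 0"
    and vars: "\<And>as. length as = n \<Longrightarrow> in_vars (n - 1) (\<gamma> as)"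
    and slot: "L.slot_linear (graded_values \<gamma>)"
    and homs: "\<And>ps. graded_values \<gamma> ps \<in> homs"
    and alt: "L.alternating (graded_values \<gamma>)"
  shows "\<gamma> \<in> cochains sA sM n"
proof -
  have eval: "M.eval \<phi> (\<gamma> (map snd ps @ [b])) = graded_values \<gamma> ps (sum_list (map fst ps)) b"
    if "Suc (length ps) = n" "\<And>j. j < n - 1 \<Longrightarrow> fst (ps ! j) = \<phi> j" for \<phi> ps b
    by (rule graded_values_eqI[OF vars]) (use that in auto)
  have slot_eval: "M.eval \<phi> (\<gamma> (as[i := sA q x + y]))
      = sM (pcompose q (if i < n - 1 then [:- \<phi> i:] else [:\<Sum>j<n - 1. \<phi> j, 1:]))
          (M.eval \<phi> (\<gamma> (as[i := x]))) + M.eval \<phi> (\<gamma> (as[i := y]))"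
    if as: "length as = n" and i: "i < n" for as i \<phi> q x y
  proof -
    obtain bs b where bs: "as = bs @ [b]" "Suc (length bs) = n"
      using as n by (metis length_append_singleton length_0_conv not_one_le_zero rev_exhaust)
    \<comment> \<open>The numbers of the assignment are attached to the arguments as degrees, so
      that evaluation becomes a graded value.\<close>
    define ps where "ps = zip (map \<phi> [0..<n - 1]) bs"
    have ps: "length ps = n - 1" "map snd ps = bs" "\<And>j. j < n - 1 \<Longrightarrow> ps ! j = (\<phi> j, bs ! j)"
      using bs by (auto simp: ps_def)
    show ?thesis
    proof (cases "i < n - 1")
      case True
      let ?ps = "\<lambda>x. take i ps @ (\<phi> i, x) # drop (Suc i) ps"
      have "i < length bs"
        using True bs by simp
      have upd: "?ps x = ps[i := (\<phi> i, x)]" for x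
        using True ps by (simp add: upd_conv_take_nth_drop)
      have "M.eval \<phi> (\<gamma> (as[i := x])) = graded_values \<gamma> (?ps x) (sum_list (map fst (?ps x))) b" for x
      proof -
        have "as[i := x] = map snd (ps[i := (\<phi> i, x)]) @ [b]"
          using \<open>i < length bs\<close> bs ps by (simp add: list_update_append map_update)
        moreover have "fst (ps[i := (\<phi> i, x)] ! j) = \<phi> j" if "j < n - 1" for j
          using that True ps by (simp add: nth_list_update)
        ultimately show ?thesis
          using eval[of "ps[i := (\<phi> i, x)]" \<phi> b] ps n by (simp add: upd)
      qed
      then show ?thesis
        using True L.slot_linearD[OF slot, of "take i ps" "\<phi> i" q x y "drop (Suc i) ps"]
        by (simp add: hom_scale_def pcompose_pCons_0)
    next
      case False
      then have "i = length bs"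
        using i bs by simp
      have "M.eval \<phi> (\<gamma> (as[i := x])) = graded_values \<gamma> ps (sum_list (map fst ps)) x" for x
      proof -
        have "as[i := x] = map snd ps @ [x]"
          using \<open>i = length bs\<close> bs ps by simp
        then show ?thesis using eval[of ps \<phi> x] ps n by simp
      qed
      moreover have "sum_list (map fst ps) = (\<Sum>j<n - 1. \<phi> j)"
        using ps by (simp add: sum_list_sum_nth atLeast0LessThan)
      ultimately show ?thesis
        using False homsD[OF homs[of ps]] by simp
    qed
  qed
  \<comment> \<open>With q = 1 and zero arguments \<open>slot_eval\<close> reads v = v + v.\<close>
  have slot_zero: "\<gamma> (as[i := 0]) = 0" if "length as = n" "i < n" for as i
    using slot_eval[OF that, of _ 1 0 0]
    by (intro M.lpoly_eqI) (simp add: pcompose_1 del: if_split)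
  have "Vector_Spaces.linear (\<lambda>c. sA [:c:]) (\<lambda>c. lsmult sM (lconst [:c:])) (\<lambda>x. \<gamma> (as[i := x]))"
    if "length as = n" "i < n" for as i
    unfolding Vector_Spaces.linear_iff
  proof (intro conjI allI)
    fix x y c
    show "\<gamma> (as[i := x + y]) = \<gamma> (as[i := x]) + \<gamma> (as[i := y])"
      using slot_eval[OF that, of _ 1 x y] by (intro M.lpoly_eqI) (simp add: pcompose_1 del: if_split)
    show "\<gamma> (as[i := sA [:c:] x]) = lsmult sM (lconst [:c:]) (\<gamma> (as[i := x]))"
      using slot_eval[OF that, of _ "[:c:]" x 0] slot_zero[OF that] by (intro M.lpoly_eqI) simp
  qed (rule A.vector_space_const vector_space_lsmult)+
  moreover have "\<gamma> (as[i := dpart sA (as ! i)]) = lsmult sM (- lam i) (\<gamma> as)"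
    if "length as = n" "i < n - 1" for as i
    using slot_eval[of as i _ "[:0, 1:]" "as ! i" 0] slot_zero[of as i] that
    by (intro M.lpoly_eqI) (simp add: pcompose_pCons)
  moreover have "\<gamma> (as[n - 1 := dpart sA (as ! (n - 1))]) = lsmult sM (dsym + (\<Sum>j<n - 1. lam j)) (\<gamma> as)"
    if "length as = n" for as
    using slot_eval[of as "n - 1" _ "[:0, 1:]" "as ! (n - 1)" 0] slot_zero[of as "n - 1"] that n
    by (intro M.lpoly_eqI) (simp add: pcompose_pCons const_sum)
  moreover have "subst sM (\<lambda>k. lam (transpose i j k)) (\<gamma> (as[i := as ! j, j := as ! i])) = - \<gamma> as"
    if as: "length as = n" and ij: "i < j" "j < n - 1" for as i j
  proof (rule M.lpoly_eqI)
    fix \<phi> :: "nat \<Rightarrow> complex"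
    obtain bs b where bs: "as = bs @ [b]" "Suc (length bs) = n"
      using as n by (metis length_append_singleton length_0_conv not_one_le_zero rev_exhaust)
    define ps where "ps = zip (map \<phi> [0..<n - 1]) bs"
    have ps: "length ps = n - 1" "map snd ps = bs" "\<And>j. j < n - 1 \<Longrightarrow> ps ! j = (\<phi> j, bs ! j)"
      using bs by (auto simp: ps_def)
    have "i < length bs" "j < length bs"
      using ij bs by simp_all
    let ?qs = "ps[i := ps ! j, j := ps ! i]"
    have upd: "as[i := as ! j, j := as ! i] = map snd ?qs @ [b]"
      using \<open>i < length bs\<close> \<open>j < length bs\<close> bs ps
      by (simp add: list_update_append nth_append map_update)
    have "M.eval \<phi> (subst sM (\<lambda>k. lam (transpose i j k)) (\<gamma> (as[i := as ! j, j := as ! i])))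
        = M.eval (\<lambda>k. \<phi> (transpose i j k)) (\<gamma> (as[i := as ! j, j := as ! i]))"
      by (rule M.eval_subst[OF vars]) (simp_all add: as)
    also have "\<dots> = graded_values \<gamma> ?qs (sum_list (map fst ?qs)) b"
      unfolding upd using ij ps n by (intro eval) (auto simp: nth_list_update transpose_def)
    also have "\<dots> = - graded_values \<gamma> ps (sum_list (map fst ps)) b"
    proof -
      \<comment> \<open>Splitting at \<open>i\<close> and \<open>j\<close> brings the exchange into
        the form of \<open>alternating_swap\<close>.\<close>
      define u w v where "u = take i ps" and "w = take (j - Suc i) (drop (Suc i) ps)"
        and "v = drop (Suc j) ps"
      have len: "length u = i" "length w = j - Suc i"
        using ij ps by (simp_all add: u_def w_def)
      have split: "ps = u @ ps ! i # w @ ps ! j # v"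
        using ij ps id_take_nth_drop[of i ps] id_take_nth_drop[of "j - Suc i" "drop (Suc i) ps"]
        by (simp add: u_def w_def v_def)
      have "(u @ x # w @ y # v)[i := y, j := x] = u @ y # w @ x # v" for x y
        using list_update_length[of u x "w @ y # v" y] list_update_length[of "u @ y # w" y v x] len ij
        by simp
      then have qs: "?qs = u @ ps ! j # w @ ps ! i # v"
        using split by metis
      have "graded_values \<gamma> ?qs = - graded_values \<gamma> ps"
        unfolding qs using L.alternating_swap[OF alt, of u "ps ! j" w "ps ! i" v] split by simp
      moreover have "sum_list (map fst ?qs) = sum_list (map fst ps)"
        unfolding qs using arg_cong[OF split, of "\<lambda>xs. sum_list (map fst xs)"]
        by (simp add: ac_simps)
      ultimately show ?thesis by simp
    qed
    also have "graded_values \<gamma> ps (sum_list (map fst ps)) b = M.eval \<phi> (\<gamma> as)"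
      using eval[of ps \<phi> b] bs ps n by simp
    finally show "M.eval \<phi> (subst sM (\<lambda>k. lam (transpose i j k)) (\<gamma> (as[i := as ! j, j := as ! i])))
        = M.eval \<phi> (- \<gamma> as)" by simp
  qed
  ultimately show ?thesis
    using zero vars by (simp add: cochains_def)
qed

end

theorem theorem3p13:
  fixes sA :: "complex poly \<Rightarrow> 'a::ab_group_add \<Rightarrow> 'a"
    and mul :: "'a \<Rightarrow> 'a \<Rightarrow> 'a poly"
    and sM :: "complex poly \<Rightarrow> 'm::ab_group_add \<Rightarrow> 'm"
    and lact :: "'a \<Rightarrow> 'm \<Rightarrow> 'm poly"
    and ract :: "'m \<Rightarrow> 'a \<Rightarrow> 'm poly"
    and n :: nat
    and \<gamma> :: "'a list \<Rightarrow> 'm lpoly"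
  assumes "left_symmetric_conformal_algebra sA mul"
    and "lsca_module sA mul sM lact ract"
    and "n \<ge> 1"
    and "\<gamma> \<in> cochains sA sM n"
  shows "coboundary sA mul sM lact ract n \<gamma> \<in> cochains sA sM (n + 1)
    \<and> coboundary sA mul sM lact ract (n + 1) (coboundary sA mul sM lact ract n \<gamma>) = (\<lambda>_. 0)"
proof -
  interpret lsca_module sA mul sM lact ract by fact
  note cochain = assms(3,4)
  let ?\<delta> = "coboundary sA mul sM lact ract n \<gamma>"
  let ?G = "graded_values \<gamma>"
  have \<delta>: "graded_values ?\<delta> = L.differential ?G"
    by (rule graded_values_coboundary[OF cochain])
  have G: "L.slot_linear ?G" "\<And>ps. ?G ps \<in> homs" "L.alternating ?G"
    using cochain by (rule cochain_slot_linear cochain_in_homs cochain_alternating)+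
  \<comment> \<open>This also serves the square, since \<open>eval_coboundary\<close> is applied a
    second time, to \<open>?\<delta>\<close>.\<close>
  have in_cochains: "?\<delta> \<in> cochains sA sM (n + 1)"
  proof (rule cochainsI)
    show "?\<delta> as = 0" if "length as \<noteq> n + 1" for as
      using that by (simp add: coboundary_def)
    show "in_vars (n + 1 - 1) (?\<delta> as)" if "length as = n + 1" for as
      using coboundary_in_vars[OF cochain] that by simp
  qed (simp_all add: \<delta> G L.differential_slot_linear L.differential_in_H L.differential_alternating)
  have "coboundary sA mul sM lact ract (n + 1) ?\<delta> as = 0" for as
  proof (cases "length as = Suc (n + 1)")
    case True
    then obtain bs b where bs: "as = bs @ [b]" "length bs = n + 1"
      by (metis length_Suc_conv_rev)
    show ?thesis
      unfolding bs(1)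
    proof (rule M.lpoly_eqI)
      fix \<phi>
      have "M.eval \<phi> (coboundary sA mul sM lact ract (n + 1) ?\<delta> (bs @ [b]))
          = L.differential (L.differential ?G) (zip (map \<phi> [0..<n + 1]) bs) (\<Sum>j<n + 1. \<phi> j) b"
        using eval_coboundary[OF _ in_cochains bs(2), of \<phi> b] by (simp add: \<delta>)
      also have "\<dots> = 0"
        using L.differential_squared[OF G(1,2)] by simp
      finally show "M.eval \<phi> (coboundary sA mul sM lact ract (n + 1) ?\<delta> (bs @ [b])) = M.eval \<phi> 0"
        by simp
    qed
  qed (simp add: coboundary_def)
  then show ?thesis
    using in_cochains by blast
qed

end
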